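(* Let $1\le p\le q\le+\infty$, $T>0$, $x_0,x_T\in\mathbb{R}^d$, let $U$ be a closed convex subset of $L_q^m(0,T)$, and consider the fixed-endpoint problem $$\min\ \mathcal{I}(x,u)=\int_0^T\theta(x(t),u(t),t)\,dt\quad\text{subject to}\quad \dot x(t)=A(t)x(t)+B(t)u(t),\ t\in[0,T],\ u\in U,\ x(0)=x_0,\ x(T)=x_T \qquad(\ast)$$ over $(x,u)\in X=W^d_{1,p}(0,T)\times L^m_q(0,T)$. Let $A$ be the set of all $(x,u)\in X$ with $x(0)=x_0$, $u\in U$ and $\dot x(t)=A(t)x(t)+B(t)u(t)$ for a.e. $t\in[0,T]$; put $\varphi(x,u)=|x(T)-x_T|$ and $\Phi_\lambda(x,u)=\mathcal{I}(x,u)+\lambda|x(T)-x_T|$. Suppose that: 1. $A(\cdot)\in L_\infty^{d\times d}(0,T)$ and $B(\cdot)\in L_\infty^{d\times m}(0,T)$; 2. $\theta\colon\mathbb{R}^d\times\mathbb{R}^m\times[0,T]\to\mathbb{R}$, $\theta=\theta(x,u,t)$, is continuous, differentiable in $x$ and $u$, and $\nabla_x\theta$ and $\nabla_u\theta$ are continuous; 3. either $q=+\infty$, or $\theta$ and $\nabla_x\theta$ satisfy the growth condition of order $(q,1)$ while $\nabla_u\theta$ satisfies the growth condition of order $(q-1,q')$; 4. there exists a globally optimal solution of $(\ast)$, and $x_T$ belongs to the relative interior of the reachable set $\mathcal{R}(x_0,T)$; 5. the set $U$ is bounded in $L^m_q(0,T)$. Then the penalty function $\Phi_\lambda$ for problem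 $(\ast)$ is completely exact on $A$.
   Context: Spaces: $L^m_q(0,T)$ is the product of $m$ copies of $L^q(0,T)$ with norm $\|u\|_q=(\int_0^T|u(t)|^q\,dt)^{1/q}$ (ess sup of the Euclidean norm $|u(t)|$ if $q=+\infty$). $W^d_{1,p}(0,T)$ is the space of absolutely continuous $x\colon[0,T]\to\mathbb{R}^d$ with $\dot x\in L^d_p(0,T)$, norm $\|x\|_{1,p}=\|x\|_p+\|\dot x\|_p$. $X$ carries the sum norm. $r'$ is the conjugate exponent of $r$. Growth condition: $g\colon\mathbb{R}^d\times\mathbb{R}^m\times[0,T]\to\mathbb{R}^k$ satisfies the growth condition of order $(l,s)$, $0\le l<+\infty$, $1\le s\le+\infty$, if for any $R>0$ there exist $C_R>0$ and an a.e. nonnegative $\omega_R\in L^s(0,T)$ with $|g(x,u,t)|\le C_R|u|^l+\omega_R(t)$ for a.e. $t\in[0,T]$ and all $(x,u)$ with $|x|\le R$. Reachable set: $\mathcal{R}(x_0,T)=\{x(T)\mid (x,u)\in A\}$, a convex set; its relative interior is the interior relative to its affine hull. The symbol $A$ (without argument) is a subset of $X$, $A(\cdot)$ is a matrix function. $\Omega=\{(x,u)\in A\mid\varphi(x,u)=0\}$ is the feasible set of $(\ast)$. For $K\subseteq X$, $f\colon X\to\mathbb{R}$ and $z\in K$, $f^{\downarrow}_K(z)=\liminf_{y\to z,\,y\in K}\frac{f(y)-f(z)}{\|y-z\|_X}$ ($+\infty$ if $z$ is isolated in $K$); $z$ is an inf-stationary point of $f$ on $K$ if $f^{\downarrow}_K(z)\ge0$.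 "$\Phi_\lambda$ is completely exact on $A$" means: there exists $\lambda^*\ge0$ such that for every $\lambda\ge\lambda^*$: (1) the optimal values of $\min_\Omega\mathcal{I}$ and $\min_A\Phi_\lambda$ coincide; (2) their globally optimal solutions coincide; (3) $z\in A$ is a locally optimal solution of $\min_A\Phi_\lambda$ iff $z\in\Omega$ and $z$ is a locally optimal solution of $\min_\Omega\mathcal{I}$; (4) $z\in A$ is an inf-stationary point of $\Phi_\lambda$ on $A$ iff $z\in\Omega$ and $z$ is an inf-stationary point of $\mathcal{I}$ on $\Omega$. Local optimality is with respect to the norm of $X$. *)

theory Defs
  imports "HOL-Analysis.Analysis" "HOL-Probability.Essential_Supremum"
begin

text \<open>
  Elements of the function spaces on \<open>[0,T]\<close> are represented by functions of type \<open>real \<Rightarrow> _\<close>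
  (values outside \<open>[0,T]\<close> play no role), and not by classes modulo equality almost everywhere.
  Hence the norms below are seminorms on representatives, and \<open>y \<noteq> z\<close> in the space is
  expressed as \<open>dist y z > 0\<close> on representatives. A closed set is automatically saturated
  under equality almost everywhere, see \<open>closed_Lq\<close>.
\<close>

subsection \<open>Function spaces\<close>

definition Lq_space :: "real \<Rightarrow> ennreal \<Rightarrow> (real \<Rightarrow> 'a::euclidean_space) set" where
  "Lq_space T q = {u \<in> borel_measurable (lebesgue_on {0..T}).
     if q = \<infinity> then esssup (lebesgue_on {0..T}) (\<lambda>t. ereal (norm (u t))) < \<infinity>
     else integrable (lebesgue_on {0..T}) (\<lambda>t. norm (u t) powr enn2real q)}"

definition Lq_norm :: "real \<Rightarrow> ennreal \<Rightarrow> (real \<Rightarrow> 'a::euclidean_space) \<Rightarrow> real" where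
  "Lq_norm T q u =
     (if q = \<infinity> then real_of_ereal (esssup (lebesgue_on {0..T}) (\<lambda>t. ereal (norm (u t))))
      else (\<integral>t. norm (u t) powr enn2real q \<partial>lebesgue_on {0..T}) powr (1 / enn2real q))"

definition absolutely_continuous_fun :: "real \<Rightarrow> (real \<Rightarrow> 'a::euclidean_space) \<Rightarrow> bool" where
  "absolutely_continuous_fun T x \<longleftrightarrow>
     (\<forall>\<epsilon>>0. \<exists>\<delta>>0. \<forall>(n::nat) a b.
        (\<forall>i<n. 0 \<le> a i \<and> a i \<le> b i \<and> b i \<le> T) \<longrightarrow>
        (\<forall>i<n. \<forall>j<n. i \<noteq> j \<longrightarrow> {a i<..<b i} \<inter> {a j<..<b j} = {}) \<longrightarrow>
        (\<Sum>i<n. b i - a i) < \<delta> \<longrightarrow>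
        (\<Sum>i<n. norm (x (b i) - x (a i))) < \<epsilon>)"

definition time_deriv :: "real \<Rightarrow> (real \<Rightarrow> 'a::euclidean_space) \<Rightarrow> real \<Rightarrow> 'a" where
  "time_deriv T x t = vector_derivative x (at t within {0..T})"

definition W1p_space :: "real \<Rightarrow> ennreal \<Rightarrow> (real \<Rightarrow> 'a::euclidean_space) set" where
  "W1p_space T p = {x. absolutely_continuous_fun T x \<and> time_deriv T x \<in> Lq_space T p}"

definition W1p_norm :: "real \<Rightarrow> ennreal \<Rightarrow> (real \<Rightarrow> 'a::euclidean_space) \<Rightarrow> real" where
  "W1p_norm T p x = Lq_norm T p x + Lq_norm T p (time_deriv T x)"

type_synonym ('d, 'm) trajectory = "(real \<Rightarrow> real ^ 'd) \<times> (real \<Rightarrow> real ^ 'm)"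

definition X_space :: "real \<Rightarrow> ennreal \<Rightarrow> ennreal \<Rightarrow> ('d::finite, 'm::finite) trajectory set" where
  "X_space T p q = W1p_space T p \<times> Lq_space T q"

definition X_dist :: "real \<Rightarrow> ennreal \<Rightarrow> ennreal \<Rightarrow>
    ('d::finite, 'm::finite) trajectory \<Rightarrow> ('d, 'm) trajectory \<Rightarrow> real" where
  "X_dist T p q y z =
     W1p_norm T p (\<lambda>t. fst y t - fst z t) + Lq_norm T q (\<lambda>t. snd y t - snd z t)"

definition closed_Lq :: "real \<Rightarrow> ennreal \<Rightarrow> (real \<Rightarrow> 'a::euclidean_space) set \<Rightarrow> bool" where
  "closed_Lq T q U \<longleftrightarrow>
     (\<forall>u \<in> Lq_space T q. (\<forall>e>0. \<exists>v\<in>U. Lq_norm T q (\<lambda>t. u t - v t) < e) \<longrightarrow> u \<in> U)"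

definition convex_fun_set :: "(real \<Rightarrow> 'a::euclidean_space) set \<Rightarrow> bool" where
  "convex_fun_set U \<longleftrightarrow>
     (\<forall>u\<in>U. \<forall>v\<in>U. \<forall>a b. 0 \<le> a \<longrightarrow> 0 \<le> b \<longrightarrow> a + b = 1 \<longrightarrow>
        (\<lambda>t. a *\<^sub>R u t + b *\<^sub>R v t) \<in> U)"

definition bounded_Lq :: "real \<Rightarrow> ennreal \<Rightarrow> (real \<Rightarrow> 'a::euclidean_space) set \<Rightarrow> bool" where
  "bounded_Lq T q U \<longleftrightarrow> (\<exists>C. \<forall>u\<in>U. Lq_norm T q u \<le> C)"

definition conjugate_exponent :: "ennreal \<Rightarrow> ennreal" where
  "conjugate_exponent r =
     (if r = 1 then \<infinity> else if r = \<infinity> then 1 else ennreal (enn2real r / (enn2real r - 1)))"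

text \<open>The case distinction implements the convention \<open>a ^ 0 = 1\<close> also for \<open>a = 0\<close>, where
  \<open>0 powr 0 = 0\<close>.\<close>

definition growth_condition :: "real \<Rightarrow> real \<Rightarrow> ennreal \<Rightarrow>
    ('a::euclidean_space \<Rightarrow> 'b::euclidean_space \<Rightarrow> real \<Rightarrow> 'c::euclidean_space) \<Rightarrow> bool" where
  "growth_condition T l s g \<longleftrightarrow>
     (\<forall>R>0. \<exists>C>0. \<exists>\<omega> \<in> Lq_space T s.
        (AE t in lebesgue_on {0..T}. (0::real) \<le> \<omega> t) \<and>
        (AE t in lebesgue_on {0..T}. \<forall>x u. norm x \<le> R \<longrightarrow>
           norm (g x u t) \<le> C * (if l = 0 then 1 else norm u powr l) + \<omega> t))"


subsection \<open>Optimality, inf-stationarity and complete exactness\<close>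

text \<open>In this subsection \<open>d\<close> is a (pseudo)distance.\<close>

definition global_min_on :: "('z \<Rightarrow> real) \<Rightarrow> 'z set \<Rightarrow> 'z \<Rightarrow> bool" where
  "global_min_on f K z \<longleftrightarrow> z \<in> K \<and> (\<forall>y\<in>K. f z \<le> f y)"

definition local_min_on :: "('z \<Rightarrow> 'z \<Rightarrow> real) \<Rightarrow> ('z \<Rightarrow> real) \<Rightarrow> 'z set \<Rightarrow> 'z \<Rightarrow> bool" where
  "local_min_on d f K z \<longleftrightarrow> z \<in> K \<and> (\<exists>r>0. \<forall>y\<in>K. d y z < r \<longrightarrow> f z \<le> f y)"

definition optimal_value :: "('z \<Rightarrow> real) \<Rightarrow> 'z set \<Rightarrow> ereal" where
  "optimal_value f K = (INF z\<in>K. ereal (f z))"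

definition punctured_nhds :: "('z \<Rightarrow> 'z \<Rightarrow> real) \<Rightarrow> 'z set \<Rightarrow> 'z \<Rightarrow> 'z filter" where
  "punctured_nhds d K z = (INF r\<in>{0<..}. principal {y \<in> K. 0 < d y z \<and> d y z < r})"

text \<open>If \<open>z\<close> is isolated in \<open>K\<close>, the filter is \<open>bot\<close> and the \<open>Liminf\<close> is \<open>\<infinity>\<close>.\<close>

definition descent_rate :: "('z \<Rightarrow> 'z \<Rightarrow> real) \<Rightarrow> ('z \<Rightarrow> real) \<Rightarrow> 'z set \<Rightarrow> 'z \<Rightarrow> ereal" where
  "descent_rate d f K z = Liminf (punctured_nhds d K z) (\<lambda>y. ereal ((f y - f z) / d y z))"

definition inf_stationary :: "('z \<Rightarrow> 'z \<Rightarrow> real) \<Rightarrow> ('z \<Rightarrow> real) \<Rightarrow> 'z set \<Rightarrow> 'z \<Rightarrow> bool" where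
  "inf_stationary d f K z \<longleftrightarrow> z \<in> K \<and> 0 \<le> descent_rate d f K z"

definition penalty_fun :: "('z \<Rightarrow> real) \<Rightarrow> ('z \<Rightarrow> real) \<Rightarrow> real \<Rightarrow> 'z \<Rightarrow> real" where
  "penalty_fun f \<phi> c z = f z + c * \<phi> z"

definition feasible_set :: "('z \<Rightarrow> real) \<Rightarrow> 'z set \<Rightarrow> 'z set" where
  "feasible_set \<phi> K = {z \<in> K. \<phi> z = 0}"

definition completely_exact ::
    "('z \<Rightarrow> 'z \<Rightarrow> real) \<Rightarrow> ('z \<Rightarrow> real) \<Rightarrow> ('z \<Rightarrow> real) \<Rightarrow> 'z set \<Rightarrow> bool" where
  "completely_exact d f \<phi> K \<longleftrightarrow>
     (\<exists>c0\<ge>0. \<forall>c\<ge>c0.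
        optimal_value f (feasible_set \<phi> K) = optimal_value (penalty_fun f \<phi> c) K \<and>
        {z. global_min_on f (feasible_set \<phi> K) z} = {z. global_min_on (penalty_fun f \<phi> c) K z} \<and>
        (\<forall>z\<in>K. local_min_on d (penalty_fun f \<phi> c) K z \<longleftrightarrow>
           z \<in> feasible_set \<phi> K \<and> local_min_on d f (feasible_set \<phi> K) z) \<and>
        (\<forall>z\<in>K. inf_stationary d (penalty_fun f \<phi> c) K z \<longleftrightarrow>
           z \<in> feasible_set \<phi> K \<and> inf_stationary d f (feasible_set \<phi> K) z))"


subsection \<open>The linear fixed-endpoint optimal control problem\<close>

definition cost :: "real \<Rightarrow> (real ^ 'd \<Rightarrow> real ^ 'm \<Rightarrow> real \<Rightarrow> real) \<Rightarrow>
    ('d::finite, 'm::finite) trajectory \<Rightarrow> real" where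
  "cost T \<theta> z = (\<integral>t. \<theta> (fst z t) (snd z t) t \<partial>lebesgue_on {0..T})"

definition endpoint_penalty :: "real \<Rightarrow> real ^ 'd \<Rightarrow> ('d::finite, 'm::finite) trajectory \<Rightarrow> real" where
  "endpoint_penalty T xT z = norm (fst z T - xT)"

definition admissible_set :: "real \<Rightarrow> ennreal \<Rightarrow> ennreal \<Rightarrow> (real \<Rightarrow> real ^ 'd ^ 'd) \<Rightarrow>
    (real \<Rightarrow> real ^ 'm ^ 'd) \<Rightarrow> (real \<Rightarrow> real ^ 'm) set \<Rightarrow> real ^ 'd \<Rightarrow>
    ('d::finite, 'm::finite) trajectory set" where
  "admissible_set T p q A B U x0 =
     {(x, u) \<in> X_space T p q. x 0 = x0 \<and> u \<in> U \<and>
        (AE t in lebesgue_on {0..T}.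
           (x has_vector_derivative (A t *v x t + B t *v u t)) (at t within {0..T}))}"

definition reachable_set :: "real \<Rightarrow> ennreal \<Rightarrow> ennreal \<Rightarrow> (real \<Rightarrow> real ^ 'd ^ 'd) \<Rightarrow>
    (real \<Rightarrow> real ^ 'm ^ 'd) \<Rightarrow> (real \<Rightarrow> real ^ 'm) set \<Rightarrow> real ^ 'd \<Rightarrow>
    (real ^ 'd::finite) set" where
  "reachable_set T p q A (B :: real \<Rightarrow> real ^ 'm::finite ^ 'd) U x0 =
     {x T | x u. (x, u) \<in> admissible_set T p q A B U x0}"

end

theory Submission
  imports Defs
begin

text \<open>
  By Gronwall's inequality a trajectory depends Lipschitz continuously on its control, so on the
  admissible set the distance of \<open>X\<close> is equivalent to the \<open>L\<^sub>q\<close>-distance of the controls, and the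
  growth conditions make the cost Lipschitz continuous for it. Since \<open>xT\<close> lies in the relative
  interior of the reachable set, every admissible \<open>z\<close> can be moved along a segment of admissible
  points towards one whose endpoint lies a fixed distance beyond \<open>xT\<close>; as the controls are
  bounded, this decreases \<open>|x(T) - xT|\<close> at a rate bounded below per unit of distance. Once the
  penalty parameter exceeds the Lipschitz constant divided by this rate, the penalty function
  strictly decreases along these segments at every infeasible point, while a feasible point at
  distance at most a multiple of \<open>|x(T) - xT|\<close> transfers optimality and stationarity between
  the two problems.
\<close>

subsection \<open>Exact penalisation from an error bound\<close>


text \<open>Two distances run through the penalty argument: local optimality and stationarity are
  measured by \<open>d\<close>, the distance of X, while the estimates are made in \<open>n\<close>,
  the distance of the controls, which is easy to follow along convex combinations. Both live on
  representatives, so distinct pairs may lie at distance 0; hence the descent step has to certify a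
  positive distance, and Lipschitz continuity has to identify values of the cost at distance 0. The
  driving estimate is that going a fraction s of the way to feasibility lowers \<phi> by s * \<phi>
  and costs at most s * a * \<phi> in distance. The constant a is D / e, where D bounds the mutual
  distances of admissible controls and e is the radius of a relative ball around \<open>xT\<close>
  in the reachable set. Boundedness of \<open>U\<close> thus enters twice: through D, and through a
  Lipschitz constant of the cost valid on the whole admissible set, so that one threshold serves all
  points. The relative interior suffices because the overshooting point is an affine combination of
  \<open>xT\<close> and a reachable endpoint.\<close>

lemma eventually_punctured_nhds:
  "eventually P (punctured_nhds d K z) \<longleftrightarrow>
     (\<exists>r>0. \<forall>y\<in>K. 0 < d y z \<and> d y z < r \<longrightarrow> P y)"
proof -
  have "eventually P (punctured_nhds d K z) \<longleftrightarrow>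
      (\<exists>r\<in>{0<..}. eventually P (principal {y \<in> K. 0 < d y z \<and> d y z < r}))"
    unfolding punctured_nhds_def
  proof (rule eventually_INF_base)
    fix a b :: real assume "a \<in> {0<..}" "b \<in> {0<..}"
    then show "\<exists>x\<in>{0<..}. principal {y \<in> K. 0 < d y z \<and> d y z < x}
        \<le> inf (principal {y \<in> K. 0 < d y z \<and> d y z < a})
          (principal {y \<in> K. 0 < d y z \<and> d y z < b})"
      by (intro bexI[of _ "min a b"]) auto
  qed auto
  then show ?thesis
    by (auto simp: eventually_principal)
qed

text \<open>Replaces the extended-real limit inferior of quotients by an epsilon-delta condition,
  the form in which stationarity is used below. At an isolated point the condition is vacuous, in
  agreement with a limit inferior of \<open>\<infinity>\<close>.\<close>

lemma inf_stationary_iff: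
  "inf_stationary d f K z \<longleftrightarrow> z \<in> K \<and>
     (\<forall>e>0. \<exists>r>0. \<forall>y\<in>K. 0 < d y z \<and> d y z < r \<longrightarrow> f z - e * d y z \<le> f y)"
proof -
  have ev: "(\<forall>e>0. \<exists>r>0. \<forall>y\<in>K. 0 < d y z \<and> d y z < r \<longrightarrow> - e < (f y - f z) / d y z) \<longleftrightarrow>
      (\<forall>e>0. \<exists>r>0. \<forall>y\<in>K. 0 < d y z \<and> d y z < r \<longrightarrow> f z - e * d y z \<le> f y)"
    (is "?L \<longleftrightarrow> ?R")
  proof
    assume L: ?L
    have "f z - e * d y z \<le> f y" if "- e < (f y - f z) / d y z" "0 < d y z" for e y
      using that by (simp add: field_simps)
    then show ?R using L by meson
  next
    assume R: ?R
    show ?L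
    proof (intro allI impI)
      fix e :: real assume "e > 0"
      \<comment> \<open>The tolerance e / 2 leaves room for the strict inequality.\<close>
      then obtain r where r: "r > 0"
        "\<And>y. y \<in> K \<Longrightarrow> 0 < d y z \<Longrightarrow> d y z < r \<Longrightarrow> f z - (e/2) * d y z \<le> f y"
        using R by (metis half_gt_zero)
      have "- e < (f y - f z) / d y z" if "y \<in> K" "0 < d y z" "d y z < r" for y
      proof -
        have "- (e * d y z) < f y - f z"
          using r(2)[OF that] mult_pos_pos[OF \<open>e > 0\<close> that(2)] by linarith
        then show ?thesis using that(2) by (simp add: field_simps)
      qed
      then show "\<exists>r>0. \<forall>y\<in>K. 0 < d y z \<and> d y z < r \<longrightarrow> - e < (f y - f z) / d y z"
        using r(1) by blast
    qed
  qed
  have "0 \<le> descent_rate d f K z \<longleftrightarrow>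
      (\<forall>a<0. eventually (\<lambda>y. a < ereal ((f y - f z) / d y z)) (punctured_nhds d K z))"
    unfolding descent_rate_def le_Liminf_iff ..
  also have "\<dots> \<longleftrightarrow>
      (\<forall>e>0::real. eventually (\<lambda>y. - e < (f y - f z) / d y z) (punctured_nhds d K z))"
    (is "?L \<longleftrightarrow> ?R")
  proof
    assume L: ?L
    show ?R
    proof (intro allI impI)
      fix e :: real assume "e > 0"
      then have "ereal (- e) < 0" by simp
      then show "eventually (\<lambda>y. - e < (f y - f z) / d y z) (punctured_nhds d K z)"
        using L[rule_format, of "ereal (- e)"] by simp
    qed
  next
    assume R: ?R
    show ?L
    proof (intro allI impI)
      fix a :: ereal assume "a < 0"
      \<comment> \<open>As a may be \<open>-\<infinity>\<close>, a real number between a and 0 is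
        inserted.\<close>
      then obtain e where e: "a < ereal e" "ereal e < 0"
        using ereal_dense2 by blast
      then have "eventually (\<lambda>y. - (- e) < (f y - f z) / d y z) (punctured_nhds d K z)"
        using R[rule_format, of "- e"] by auto
      then show "eventually (\<lambda>y. a < ereal ((f y - f z) / d y z)) (punctured_nhds d K z)"
        by eventually_elim (use e(1) in \<open>auto intro: less_trans\<close>)
    qed
  qed
  finally show ?thesis
    unfolding inf_stationary_def eventually_punctured_nhds ev by simp
qed

text \<open>The error bound in the last hypothesis is used with \<open>s = 1\<close> to project a point onto the
  feasible set, and with small \<open>s\<close> to see that the penalty function strictly decreases,
  at a linear rate, at every infeasible point.\<close>

theorem completely_exact_if_error_bound:
  fixes d n :: "'z \<Rightarrow> 'z \<Rightarrow> real"
  assumes dn: "\<And>y z. y \<in> K \<Longrightarrow> z \<in> K \<Longrightarrow> n y z \<le> d y z"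
    and d_le: "\<And>y z. y \<in> K \<Longrightarrow> z \<in> K \<Longrightarrow> d y z \<le> k * n y z"
    and n_nonneg: "\<And>y z. 0 \<le> n y z"
    and n_refl: "\<And>z. n z z = 0"
    and n_sym: "\<And>y z. n y z = n z y"
    and n_tri: "\<And>x y z. x \<in> K \<Longrightarrow> y \<in> K \<Longrightarrow> z \<in> K \<Longrightarrow> n x z \<le> n x y + n y z"
    and f_lip: "\<And>y z. y \<in> K \<Longrightarrow> z \<in> K \<Longrightarrow> \<bar>f y - f z\<bar> \<le> L * n y z"
    and phi_lip: "\<And>y z. y \<in> K \<Longrightarrow> z \<in> K \<Longrightarrow> \<phi> y - \<phi> z \<le> C * n y z"
    and phi_nonneg: "\<And>z. 0 \<le> \<phi> z"
    and constants: "0 < k" "0 \<le> L" "0 \<le> C" "0 < a"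
    and error_bound: "\<And>z s. z \<in> K \<Longrightarrow> 0 < \<phi> z \<Longrightarrow> 0 < s \<Longrightarrow> s \<le> 1 \<Longrightarrow>
       \<exists>y\<in>K. \<phi> y = (1 - s) * \<phi> z \<and> n y z \<le> s * (a * \<phi> z)"
  shows "completely_exact d f \<phi> K"
proof -
  define W where "W = feasible_set \<phi> K"
  have W: "z \<in> W \<longleftrightarrow> z \<in> K \<and> \<phi> z = 0" for z
    by (auto simp: W_def feasible_set_def)
  have proj: "\<exists>y\<in>W. n y z \<le> a * \<phi> z" if z: "z \<in> K" for z
  proof (cases "\<phi> z = 0")
    case True
    then show ?thesis
      using z W by (intro bexI[of _ z]) (auto simp: n_refl)
  next
    case False
    then show ?thesis
      using error_bound[OF z, of 1] phi_nonneg[of z] W by fastforce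
  qed
  have proj_value: "\<exists>y\<in>W. n y z \<le> a * \<phi> z \<and> f y \<le> f z + L * a * \<phi> z" if z: "z \<in> K" for z
  proof -
    obtain y where y: "y \<in> W" "n y z \<le> a * \<phi> z" using proj[OF z] by blast
    have "f y - f z \<le> L * n y z"
      using f_lip[of y z] y W z by force
    also have "\<dots> \<le> L * (a * \<phi> z)"
      using y(2) constants by (intro mult_left_mono) auto
    finally show ?thesis using y by (auto simp: algebra_simps)
  qed
  \<comment> \<open>Moving to the feasible set raises f by at most L * a per unit of \<phi>. The
    surplus 1 in the threshold is the rate, again per unit of \<phi>, at which the penalty function
    still decreases.\<close>
  have exact: "optimal_value f W = optimal_value (penalty_fun f \<phi> c) K \<and>
        {z. global_min_on f W z} = {z. global_min_on (penalty_fun f \<phi> c) K z} \<and>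
        (\<forall>z\<in>K. local_min_on d (penalty_fun f \<phi> c) K z \<longleftrightarrow>
           z \<in> W \<and> local_min_on d f W z) \<and>
        (\<forall>z\<in>K. inf_stationary d (penalty_fun f \<phi> c) K z \<longleftrightarrow>
           z \<in> W \<and> inf_stationary d f W z)"
    if c: "L * a + 1 \<le> c" for c
  proof -
    define P where "P = penalty_fun f \<phi> c"
    have P: "P z = f z + c * \<phi> z" for z by (simp add: P_def penalty_fun_def)
    have PW: "P z = f z" if "z \<in> W" for z using that W P by simp
    have cphi: "(L * a + 1) * \<phi> z \<le> c * \<phi> z" for z
      using c phi_nonneg[of z] by (rule mult_right_mono)
    have proj_P: "\<exists>y\<in>W. n y z \<le> a * \<phi> z \<and> f y \<le> P z" if z: "z \<in> K" for z
    proof -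
      obtain y where "y \<in> W" "n y z \<le> a * \<phi> z" "f y \<le> f z + L * a * \<phi> z"
        using proj_value[OF z] by blast
      moreover have "L * a * \<phi> z \<le> c * \<phi> z"
        using cphi[of z] phi_nonneg[of z] by (simp add: algebra_simps)
      ultimately show ?thesis using P by force
    qed
    have descent: "\<exists>y\<in>K. 0 < d y z \<and> d y z \<le> s * (k * a * \<phi> z) \<and> P y \<le> P z - s * \<phi> z"
      if z: "z \<in> K" and pos: "0 < \<phi> z" and s: "0 < s" "s \<le> 1" for z s
    proof -
      obtain y where y: "y \<in> K" "\<phi> y = (1 - s) * \<phi> z" "n y z \<le> s * (a * \<phi> z)"
        using error_bound[OF z pos s] by blast
      \<comment> \<open>Since \<phi> is Lipschitz and its value really changes, y is not at distance
        0 from z. Otherwise no punctured neighbourhood would contain y.\<close>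
      have "0 < s * \<phi> z" using pos s by simp
      also have "\<dots> \<le> C * n z y"
        using phi_lip[OF z y(1)] y(2) by (simp add: algebra_simps)
      finally have "0 < n y z"
        using constants n_nonneg[of y z] n_sym[of y z] by (auto simp: zero_less_mult_iff)
      then have "0 < d y z" using dn[OF y(1) z] by linarith
      moreover have "d y z \<le> k * (s * (a * \<phi> z))"
        using d_le[OF y(1) z] y(3) constants(1) by (smt (verit) mult_left_mono)
      moreover have "P y \<le> P z - s * \<phi> z"
      proof -
        have "f y - f z \<le> L * n y z" using f_lip[OF y(1) z] by linarith
        also have "\<dots> \<le> L * (s * (a * \<phi> z))"
          using y(3) constants by (intro mult_left_mono) auto
        finally have "f y \<le> f z + s * (L * a * \<phi> z)" by (simp add: algebra_simps)
        moreover have "s * ((L * a + 1) * \<phi> z) \<le> s * (c * \<phi> z)"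
          using cphi[of z] s by (intro mult_left_mono) auto
        moreover have "c * \<phi> y = c * \<phi> z - s * (c * \<phi> z)"
          unfolding y(2) by (simp add: algebra_simps)
        ultimately show ?thesis unfolding P by (simp add: algebra_simps)
      qed
      ultimately show ?thesis using y(1) by (auto simp: algebra_simps)
    qed
    have opt_val: "optimal_value f W = optimal_value P K"
      unfolding optimal_value_def
    proof (rule antisym)
      show "(INF z\<in>W. ereal (f z)) \<le> (INF z\<in>K. ereal (P z))"
        using proj_P by (intro INF_mono) (metis ereal_less_eq(3))
      show "(INF z\<in>K. ereal (P z)) \<le> (INF z\<in>W. ereal (f z))"
        using PW W by (intro INF_mono) (metis order_refl)
    qed
    have globals: "global_min_on f W z \<longleftrightarrow> global_min_on P K z" for z
    proof
      assume "global_min_on f W z"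
      then have z: "z \<in> W" "\<And>y. y \<in> W \<Longrightarrow> f z \<le> f y" by (auto simp: global_min_on_def)
      have "P z \<le> P w" if w: "w \<in> K" for w
      proof -
        obtain y where "y \<in> W" "f y \<le> P w" using proj_P[OF w] by blast
        then show ?thesis using z(2)[of y] PW[OF z(1)] by linarith
      qed
      then show "global_min_on P K z" using z W by (auto simp: global_min_on_def)
    next
      assume "global_min_on P K z"
      then have z: "z \<in> K" "\<And>y. y \<in> K \<Longrightarrow> P z \<le> P y" by (auto simp: global_min_on_def)
      have "\<phi> z = 0"
      proof (rule ccontr)
        assume "\<phi> z \<noteq> 0"
        then have pos: "0 < \<phi> z" using phi_nonneg[of z] by simp
        then obtain y where "y \<in> K" "P y \<le> P z - 1 * \<phi> z"
          using descent[OF z(1) pos, of 1] by auto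
        then show False using z(2)[of y] pos by linarith
      qed
      then show "global_min_on f W z" using z W PW by (auto simp: global_min_on_def) (metis)
    qed
    \<comment> \<open>Projecting w keeps it close to a feasible z: as \<phi> z = 0, \<phi> w is at
      most C * n w z, and the triangle inequality through w yields the factor 1 + a * C. The factor
      k leads back from n to d.\<close>
    have near: "d y z \<le> k * (1 + a * C) * d w z"
      if "y \<in> W" "n y w \<le> a * \<phi> w" "w \<in> K" "z \<in> W" for y w z
    proof -
      have K: "y \<in> K" "z \<in> K" using that W by auto
      have "\<phi> w \<le> C * n w z" using phi_lip[of w z] that W by force
      then have "a * \<phi> w \<le> a * (C * n w z)" using constants by simp
      then have "n y z \<le> (1 + a * C) * n w z"
        using n_tri[OF K(1) that(3) K(2)] that(2) by (simp add: algebra_simps)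
      also have "\<dots> \<le> (1 + a * C) * d w z"
        using dn[OF that(3) K(2)] constants by (intro mult_left_mono) auto
      finally have "k * n y z \<le> k * ((1 + a * C) * d w z)" using constants by simp
      then show ?thesis using d_le[OF K] by simp
    qed
    define \<rho> where "\<rho> = k * (1 + a * C)"
    have \<rho>: "\<rho> > 0" using constants by (simp add: \<rho>_def add_pos_nonneg)
    have locals: "local_min_on d P K z \<longleftrightarrow> z \<in> W \<and> local_min_on d f W z" for z
    proof
      assume "local_min_on d P K z"
      then obtain r where r: "z \<in> K" "r > 0" "\<And>y. y \<in> K \<Longrightarrow> d y z < r \<Longrightarrow> P z \<le> P y"
        by (auto simp: local_min_on_def)
      have "\<phi> z = 0"
      proof (rule ccontr)
        assume "\<phi> z \<noteq> 0"
        then have pos: "\<phi> z > 0" using phi_nonneg[of z] by simp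
        \<comment> \<open>D bounds the distance covered by the full step s = 1; s is then cut down
          so that the step stays inside the ball of radius r, with a 2 for strictness.\<close>
        define D where "D = k * a * \<phi> z"
        have D: "D > 0" using constants pos by (simp add: D_def)
        define s where "s = min 1 (r / (2 * D))"
        have s: "0 < s" "s \<le> 1" "s * D < r"
        proof -
          show "0 < s" "s \<le> 1" using D r(2) by (auto simp: s_def)
          have "s * D \<le> (r / (2 * D)) * D"
            using D by (intro mult_right_mono) (auto simp: s_def)
          then show "s * D < r" using D r(2) by simp
        qed
        obtain y where y: "y \<in> K" "d y z \<le> s * D" "P y \<le> P z - s * \<phi> z"
          using descent[OF r(1) pos s(1,2)] by (auto simp: D_def)
        then have "P z \<le> P y" using r(3)[of y] s by linarith
        then show False using y(3) mult_pos_pos[OF s(1) pos] by linarith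
      qed
      then show "z \<in> W \<and> local_min_on d f W z"
        using r W PW by (auto simp: local_min_on_def) (metis)
    next
      assume "z \<in> W \<and> local_min_on d f W z"
      then obtain r where r: "z \<in> W" "r > 0" "\<And>y. y \<in> W \<Longrightarrow> d y z < r \<Longrightarrow> f z \<le> f y"
        by (auto simp: local_min_on_def)
      have "P z \<le> P w" if w: "w \<in> K" "d w z < r / \<rho>" for w
      proof -
        obtain y where y: "y \<in> W" "n y w \<le> a * \<phi> w" "f y \<le> P w" using proj_P[OF w(1)] by blast
        have "d y z \<le> \<rho> * d w z" using near[OF y(1,2) w(1) r(1)] by (simp add: \<rho>_def)
        also have "\<dots> < r" using w(2) \<rho> by (simp add: field_simps)
        finally show ?thesis using r(3)[OF y(1)] y(3) PW[OF r(1)] by linarith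
      qed
      moreover have "r / \<rho> > 0" using r \<rho> by simp
      ultimately show "local_min_on d P K z"
        using r(1) W by (auto simp: local_min_on_def)
    qed
    have stationary: "inf_stationary d P K z \<longleftrightarrow> z \<in> W \<and> inf_stationary d f W z" for z
    proof
      assume "inf_stationary d P K z"
      then have z: "z \<in> K" and st: "\<And>e. e > 0 \<Longrightarrow>
          \<exists>r>0. \<forall>y\<in>K. 0 < d y z \<and> d y z < r \<longrightarrow> P z - e * d y z \<le> P y"
        by (auto simp: inf_stationary_iff)
      have "\<phi> z = 0"
      proof (rule ccontr)
        assume "\<phi> z \<noteq> 0"
        then have pos: "\<phi> z > 0" using phi_nonneg[of z] by simp
        define D where "D = k * a * \<phi> z"
        have D: "D > 0" using constants pos by (simp add: D_def)
        \<comment> \<open>A step lowers P by at least s * \<phi> z over a distance of at most s * D.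
          Half of this slope is the tolerance that stationarity cannot meet.\<close>
        obtain r where r: "r > 0" "\<And>y. y \<in> K \<Longrightarrow> 0 < d y z \<Longrightarrow> d y z < r \<Longrightarrow>
            P z - (\<phi> z / (2 * D)) * d y z \<le> P y"
          using st[of "\<phi> z / (2 * D)"] D pos by auto
        define s where "s = min 1 (r / (2 * D))"
        have s: "0 < s" "s \<le> 1" "s * D < r"
        proof -
          show "0 < s" "s \<le> 1" using D r(1) by (auto simp: s_def)
          have "s * D \<le> (r / (2 * D)) * D"
            using D by (intro mult_right_mono) (auto simp: s_def)
          then show "s * D < r" using D r(1) by simp
        qed
        obtain y where y: "y \<in> K" "0 < d y z" "d y z \<le> s * D" "P y \<le> P z - s * \<phi> z"
          using descent[OF z pos s(1,2)] by (auto simp: D_def)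
        have "P z - (\<phi> z / (2 * D)) * d y z \<le> P y" using r(2)[of y] y s by linarith
        moreover have "(\<phi> z / (2 * D)) * d y z \<le> (\<phi> z / (2 * D)) * (s * D)"
          using y(3) pos D by (intro mult_left_mono) auto
        moreover have "(\<phi> z / (2 * D)) * (s * D) = s * \<phi> z / 2" using D by simp
        ultimately show False using y(4) mult_pos_pos[OF s(1) pos] by linarith
      qed
      then have zW: "z \<in> W" using z W by simp
      have "\<exists>r>0. \<forall>y\<in>W. 0 < d y z \<and> d y z < r \<longrightarrow> f z - e * d y z \<le> f y" if e: "e > 0" for e
      proof -
        obtain r where "r > 0" "\<And>y. y \<in> K \<Longrightarrow> 0 < d y z \<Longrightarrow> d y z < r \<Longrightarrow> P z - e * d y z \<le> P y"
          using st[OF e] by blast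
        then show ?thesis using W PW zW by (metis (no_types, lifting))
      qed
      then show "z \<in> W \<and> inf_stationary d f W z" using zW by (simp add: inf_stationary_iff)
    next
      assume "z \<in> W \<and> inf_stationary d f W z"
      then have z: "z \<in> W" and st: "\<And>e. e > 0 \<Longrightarrow>
          \<exists>r>0. \<forall>y\<in>W. 0 < d y z \<and> d y z < r \<longrightarrow> f z - e * d y z \<le> f y"
        by (auto simp: inf_stationary_iff)
      have zK: "z \<in> K" using z W by simp
      have "\<exists>r>0. \<forall>w\<in>K. 0 < d w z \<and> d w z < r \<longrightarrow> P z - e * d w z \<le> P w" if e: "e > 0" for e
      proof -
        \<comment> \<open>The tolerance is divided by \<rho> because the projection of w may be
          \<rho> times as far from z as w is.\<close>
        obtain r where r: "r > 0" "\<And>y. y \<in> W \<Longrightarrow> 0 < d y z \<Longrightarrow> d y z < r \<Longrightarrow>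
            f z - (e / \<rho>) * d y z \<le> f y"
          using st[of "e / \<rho>"] e \<rho> by auto
        have "P z - e * d w z \<le> P w" if w: "w \<in> K" "0 < d w z" "d w z < r / \<rho>" for w
        proof -
          obtain y where y: "y \<in> W" "n y w \<le> a * \<phi> w" "f y \<le> P w" using proj_P[OF w(1)] by blast
          have yK: "y \<in> K" using y W by simp
          have dy: "d y z \<le> \<rho> * d w z" using near[OF y(1,2) w(1) z] by (simp add: \<rho>_def)
          also have "\<dots> < r" using w(3) \<rho> by (simp add: field_simps)
          finally have small: "d y z < r" .
          have "f z - e * d w z \<le> f y"
          \<comment> \<open>The projection may land at distance 0 from z, where stationarity gives
            no information; there f y = f z by Lipschitz continuity.\<close>
          proof (cases "d y z > 0")
            case True
            have "(e / \<rho>) * d y z \<le> (e / \<rho>) * (\<rho> * d w z)"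
              using dy e \<rho> by (intro mult_left_mono) auto
            then show ?thesis using r(2)[OF y(1) True small] \<rho> by simp
          next
            case False
            then have "n y z = 0" using dn[OF yK zK] n_nonneg[of y z] by linarith
            then have "f y = f z" using f_lip[OF yK zK] by simp
            then show ?thesis using mult_pos_pos[OF e w(2)] by linarith
          qed
          then show ?thesis using y(3) PW[OF z] by linarith
        qed
        moreover have "r / \<rho> > 0" using r \<rho> by simp
        ultimately show ?thesis by blast
      qed
      then show "inf_stationary d P K z" using zK by (simp add: inf_stationary_iff)
    qed
    show ?thesis
      using opt_val globals locals stationary unfolding P_def by simp
  qed
  have "0 \<le> L * a + 1" using constants by simp
  then show ?thesis
    unfolding completely_exact_def W_def[symmetric]
    by (intro exI[of _ "L * a + 1"] conjI[of "0 \<le> L * a + 1"] allI impI exact)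
qed


subsection \<open>Lebesgue norms on an interval\<close>

lemma Lq_space_measurable: "u \<in> Lq_space T q \<Longrightarrow> u \<in> borel_measurable (lebesgue_on {0..T})"
  by (simp add: Lq_space_def)

text \<open>On an interval of positive length the essential supremum of a norm is at least that of
  the constant 0. Together with the upper bound this makes it a real number, so
  \<open>real_of_ereal\<close> does not fall back on its default value.\<close>

lemma Linf_I:
  fixes u :: "real \<Rightarrow> 'a::euclidean_space"
  assumes T: "0 < T" and u: "u \<in> borel_measurable (lebesgue_on {0..T})"
    and N: "AE t in lebesgue_on {0..T}. norm (u t) \<le> N"
  shows "u \<in> Lq_space T \<infinity>" "Lq_norm T \<infinity> u \<le> N"
proof -
  let ?M = "lebesgue_on {0..T}"
  let ?e = "esssup ?M (\<lambda>t. ereal (norm (u t)))"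
  have m: "(\<lambda>t. ereal (norm (u t))) \<in> borel_measurable ?M"
    using u by measurable
  have le: "?e \<le> ereal N"
    by (rule esssup_I[OF m]) (use N in auto)
  have pos: "emeasure ?M (space ?M) \<noteq> 0"
    using T by (simp add: emeasure_restrict_space)
  have "esssup ?M (\<lambda>t. 0::ereal) \<le> ?e"
    by (rule esssup_mono) auto
  then have ge: "0 \<le> ?e"
    using esssup_const[OF pos, of "0::ereal"] by simp
  show "u \<in> Lq_space T \<infinity>"
    using u le by (auto simp: Lq_space_def)
  have "real_of_ereal ?e \<le> N"
    using le ge by (cases ?e) auto
  then show "Lq_norm T \<infinity> u \<le> N"
    by (simp add: Lq_norm_def)
qed

lemma Linf_AE:
  fixes u :: "real \<Rightarrow> 'a::euclidean_space"
  assumes T: "0 < T" and u: "u \<in> Lq_space T \<infinity>"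
  shows "AE t in lebesgue_on {0..T}. norm (u t) \<le> Lq_norm T \<infinity> u"
proof -
  let ?M = "lebesgue_on {0..T}"
  let ?e = "esssup ?M (\<lambda>t. ereal (norm (u t)))"
  have pos: "emeasure ?M (space ?M) \<noteq> 0"
    using T by (simp add: emeasure_restrict_space)
  have m: "(\<lambda>t. ereal (norm (u t))) \<in> borel_measurable ?M"
    using Lq_space_measurable[OF u] by measurable
  have "esssup ?M (\<lambda>t. 0::ereal) \<le> ?e"
    by (rule esssup_mono) auto
  then have "0 \<le> ?e" using esssup_const[OF pos, of "0::ereal"] by simp
  moreover have "?e < \<infinity>" using u by (simp add: Lq_space_def)
  ultimately have e: "?e = ereal (Lq_norm T \<infinity> u)"
    by (cases ?e) (auto simp: Lq_norm_def)
  show ?thesis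
    using esssup_AE[of "\<lambda>t. ereal (norm (u t))" ?M] unfolding e by simp
qed

lemma Lq_norm_nonneg:
  fixes u :: "real \<Rightarrow> 'a::euclidean_space"
  assumes T: "0 < T"
  shows "0 \<le> Lq_norm T q u"
proof (cases "q = \<infinity>")
  case True
  let ?M = "lebesgue_on {0..T}"
  let ?e = "esssup ?M (\<lambda>t. ereal (norm (u t)))"
  have "0 \<le> ?e"
  proof (cases "(\<lambda>t. ereal (norm (u t))) \<in> borel_measurable ?M")
    case True
    have pos: "emeasure ?M (space ?M) \<noteq> 0"
      using T by (simp add: emeasure_restrict_space)
    have "esssup ?M (\<lambda>t. 0::ereal) \<le> ?e"
      by (rule esssup_mono) auto
    then show "0 \<le> ?e" using esssup_const[OF pos, of "0::ereal"] by simp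
  next
    \<comment> \<open>A non-measurable function has essential supremum \<open>\<infinity>\<close>,
      which \<open>real_of_ereal\<close> sends to 0.\<close>
    case False
    then show ?thesis by (simp add: esssup_non_measurable)
  qed
  then show ?thesis using True by (simp add: Lq_norm_def real_of_ereal_pos)
qed (simp add: Lq_norm_def)

section \<open>Finite exponents: normalised integrals and Minkowski's inequality\<close>

lemma Lq_finite:
  assumes "q \<noteq> \<infinity>"
  shows "u \<in> Lq_space T q \<longleftrightarrow> u \<in> borel_measurable (lebesgue_on {0..T}) \<and>
      integrable (lebesgue_on {0..T}) (\<lambda>t. norm (u t) powr enn2real q)"
    and "Lq_norm T q u =
      (\<integral>t. norm (u t) powr enn2real q \<partial>lebesgue_on {0..T}) powr (1 / enn2real q)"
  using assms by (simp_all add: Lq_space_def Lq_norm_def)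

lemma enn2real_ge_1:
  assumes "1 \<le> (q::ennreal)" "q \<noteq> \<infinity>"
  shows "1 \<le> enn2real q"
  using enn2real_mono[of 1 q] assms by (simp add: less_top top.not_eq_extremum)

lemma powr_inverse_le_iff:
  assumes "0 \<le> x" "0 < (r::real)"
  shows "x powr (1 / r) \<le> y \<longleftrightarrow> x \<le> y powr r \<and> 0 \<le> y"
proof -
  have "(x powr (1 / r)) powr r = x" using assms by (simp add: powr_powr)
  moreover have "(y powr r) powr (1 / r) = y" if "0 \<le> y" using assms that by (simp add: powr_powr)
  ultimately show ?thesis
    using assms by (metis powr_ge_zero powr_mono2 less_imp_le order_trans zero_le_divide_1_iff)
qed

text \<open>The norm as a Luxemburg gauge: after scaling by any N > 0 above the norm, the integral
  of the power is at most 1. Estimates can then be made pointwise, and a vanishing norm needs no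
  case of its own once N is pushed down to the norm.\<close>

lemma Lq_norm_le_iff:
  fixes u :: "real \<Rightarrow> 'a::euclidean_space"
  assumes q: "1 \<le> q" "q \<noteq> \<infinity>" and N: "0 < N"
  shows "Lq_norm T q u \<le> N \<longleftrightarrow>
     (\<integral>t. (norm (u t) / N) powr enn2real q \<partial>lebesgue_on {0..T}) \<le> 1"
proof -
  let ?r = "enn2real q" and ?M = "lebesgue_on {0..T}"
  have r: "1 \<le> ?r" by (rule enn2real_ge_1[OF q])
  have "(\<integral>t. (norm (u t) / N) powr ?r \<partial>?M) = (\<integral>t. norm (u t) powr ?r / N powr ?r \<partial>?M)"
    using N by (simp add: powr_divide)
  also have "\<dots> = (\<integral>t. norm (u t) powr ?r \<partial>?M) / N powr ?r" by simp
  finally have eq: "(\<integral>t. (norm (u t) / N) powr ?r \<partial>?M) = (\<integral>t. norm (u t) powr ?r \<partial>?M) / N powr ?r" .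
  have "(\<integral>t. (norm (u t) / N) powr ?r \<partial>?M) \<le> 1 \<longleftrightarrow>
      (\<integral>t. norm (u t) powr ?r \<partial>?M) \<le> N powr ?r"
    unfolding eq using N by (simp add: divide_le_eq_1)
  also have "\<dots> \<longleftrightarrow> Lq_norm T q u \<le> N"
    unfolding Lq_finite(2)[OF q(2)]
    by (subst powr_inverse_le_iff) (use r N in auto)
  finally show ?thesis by simp
qed

lemma Lq_scaled_integrable:
  fixes u :: "real \<Rightarrow> 'a::euclidean_space"
  assumes q: "1 \<le> q" "q \<noteq> \<infinity>" and N: "0 < N" and u: "u \<in> Lq_space T q"
  shows "integrable (lebesgue_on {0..T}) (\<lambda>t. (norm (u t) / N) powr enn2real q)"
proof -
  have "integrable (lebesgue_on {0..T}) (\<lambda>t. norm (u t) powr enn2real q / N powr enn2real q)"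
    using u q by (simp add: Lq_finite)
  then show ?thesis using N by (simp add: powr_divide)
qed

text \<open>The two functions may take values in different spaces, so a vector function can be
  compared with a scalar majorant.\<close>

lemma Lq_mono:
  fixes u :: "real \<Rightarrow> 'a::euclidean_space" and v :: "real \<Rightarrow> 'b::euclidean_space"
  assumes T: "0 < T" and q: "1 \<le> q" and u: "u \<in> borel_measurable (lebesgue_on {0..T})"
    and v: "v \<in> Lq_space T q" and le: "AE t in lebesgue_on {0..T}. norm (u t) \<le> norm (v t)"
  shows "u \<in> Lq_space T q" "Lq_norm T q u \<le> Lq_norm T q v"
proof -
  have "u \<in> Lq_space T q \<and> Lq_norm T q u \<le> Lq_norm T q v"
  proof (cases "q = \<infinity>")
    case True
    have "AE t in lebesgue_on {0..T}. norm (u t) \<le> Lq_norm T \<infinity> v"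
      using le Linf_AE[OF T v[unfolded True]] by eventually_elim simp
    then show ?thesis using Linf_I[OF T u] True by blast
  next
    case False
    let ?r = "enn2real q" and ?M = "lebesgue_on {0..T}"
    have r: "1 \<le> ?r" by (rule enn2real_ge_1[OF q False])
    have vi: "integrable ?M (\<lambda>t. norm (v t) powr ?r)" using v False by (simp add: Lq_finite)
    have le': "AE t in ?M. norm (u t) powr ?r \<le> norm (v t) powr ?r"
      using le by eventually_elim (use r in \<open>auto intro: powr_mono2\<close>)
    have m: "(\<lambda>t. norm (u t) powr ?r) \<in> borel_measurable ?M" using u by measurable
    have ui: "integrable ?M (\<lambda>t. norm (u t) powr ?r)"
      by (rule Bochner_Integration.integrable_bound[OF vi m]) (use le' in auto)
    have "(\<integral>t. norm (u t) powr ?r \<partial>?M) \<le> (\<integral>t. norm (v t) powr ?r \<partial>?M)"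
      by (rule integral_mono_AE[OF ui vi le'])
    then have "Lq_norm T q u \<le> Lq_norm T q v"
      unfolding Lq_finite(2)[OF False] using r by (intro powr_mono2) auto
    then show ?thesis using u ui False by (simp add: Lq_finite)
  qed
  then show "u \<in> Lq_space T q" "Lq_norm T q u \<le> Lq_norm T q v" by auto
qed

lemma Lq_scaleR:
  fixes u :: "real \<Rightarrow> 'a::euclidean_space"
  assumes T: "0 < T" and q: "1 \<le> q" and u: "u \<in> Lq_space T q"
  shows "(\<lambda>t. c *\<^sub>R u t) \<in> Lq_space T q" "Lq_norm T q (\<lambda>t. c *\<^sub>R u t) \<le> \<bar>c\<bar> * Lq_norm T q u"
proof -
  note [measurable] = Lq_space_measurable[OF u]
  have m: "(\<lambda>t. c *\<^sub>R u t) \<in> borel_measurable (lebesgue_on {0..T})" by measurable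
  have "(\<lambda>t. c *\<^sub>R u t) \<in> Lq_space T q \<and>
      Lq_norm T q (\<lambda>t. c *\<^sub>R u t) \<le> \<bar>c\<bar> * Lq_norm T q u"
  proof (cases "q = \<infinity>")
    case True
    have "AE t in lebesgue_on {0..T}. norm (c *\<^sub>R u t) \<le> \<bar>c\<bar> * Lq_norm T \<infinity> u"
      using Linf_AE[OF T u[unfolded True]] by eventually_elim (simp add: mult_left_mono)
    then show ?thesis using Linf_I[OF T m] True by blast
  next
    case False
    let ?r = "enn2real q" and ?M = "lebesgue_on {0..T}"
    have r: "1 \<le> ?r" by (rule enn2real_ge_1[OF q False])
    have eq: "(\<lambda>t. norm (c *\<^sub>R u t) powr ?r) = (\<lambda>t. \<bar>c\<bar> powr ?r * norm (u t) powr ?r)"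
      by (simp add: powr_mult)
    have "Lq_norm T q (\<lambda>t. c *\<^sub>R u t) =
        (\<bar>c\<bar> powr ?r * (\<integral>t. norm (u t) powr ?r \<partial>?M)) powr (1 / ?r)"
      unfolding Lq_finite(2)[OF False] eq by simp
    also have "\<dots> = \<bar>c\<bar> * Lq_norm T q u"
      unfolding Lq_finite(2)[OF False] using r by (simp add: powr_mult powr_powr)
    finally have "Lq_norm T q (\<lambda>t. c *\<^sub>R u t) \<le> \<bar>c\<bar> * Lq_norm T q u" by simp
    moreover have "integrable ?M (\<lambda>t. norm (c *\<^sub>R u t) powr ?r)"
      unfolding eq using u False by (simp add: Lq_finite)
    ultimately show ?thesis using m False by (simp add: Lq_finite(1))
  qed
  then show "(\<lambda>t. c *\<^sub>R u t) \<in> Lq_space T q"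
    "Lq_norm T q (\<lambda>t. c *\<^sub>R u t) \<le> \<bar>c\<bar> * Lq_norm T q u" by auto
qed

text \<open>Convexity of the power on the open half-line. If x or y is 0, the claim reduces to a
  powr r \<le> a for a in [0,1].\<close>

lemma powr_convex_combination:
  assumes "1 \<le> (r::real)" "0 \<le> x" "0 \<le> y" "0 \<le> a" "0 \<le> b" "a + b = 1"
  shows "(a * x + b * y) powr r \<le> a * x powr r + b * y powr r"
proof -
  have key: "(a * x) powr r \<le> a * x powr r" if "0 \<le> a" "a \<le> 1" "0 \<le> x" for a x :: real
  proof (cases "a = 0")
    case False
    then have "a powr r \<le> a powr 1" using that assms(1) by (intro powr_mono') auto
    then show ?thesis using that by (simp add: powr_mult mult_right_mono)
  qed simp
  show ?thesis
  proof (cases "x = 0 \<or> y = 0")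
    case True
    then show ?thesis
      using key[of b y] key[of a x] assms by auto
  next
    case False
    moreover have "a = 1 - b" using assms(6) by simp
    ultimately show ?thesis
      using convex_onD[OF powr_convex[OF assms(1)], of b x y] assms(2-5) by simp
  qed
qed

text \<open>Minkowski by convexity: for a and b above the two norms, (u + v) / (a + b) is the
  combination of u / a and v / b with weights a / (a + b) and b / (a + b). Integrating the convexity
  inequality bounds the norm of the sum by a + b; then a and b tend to the norms.\<close>

lemma Lq_add:
  fixes u v :: "real \<Rightarrow> 'a::euclidean_space"
  assumes T: "0 < T" and q: "1 \<le> q" and u: "u \<in> Lq_space T q" and v: "v \<in> Lq_space T q"
  shows "(\<lambda>t. u t + v t) \<in> Lq_space T q"
    "Lq_norm T q (\<lambda>t. u t + v t) \<le> Lq_norm T q u + Lq_norm T q v"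
proof -
  note [measurable] = Lq_space_measurable[OF u] Lq_space_measurable[OF v]
  have m: "(\<lambda>t. u t + v t) \<in> borel_measurable (lebesgue_on {0..T})" by measurable
  have "(\<lambda>t. u t + v t) \<in> Lq_space T q \<and>
      Lq_norm T q (\<lambda>t. u t + v t) \<le> Lq_norm T q u + Lq_norm T q v"
  proof (cases "q = \<infinity>")
    case True
    have "AE t in lebesgue_on {0..T}. norm (u t + v t) \<le> Lq_norm T \<infinity> u + Lq_norm T \<infinity> v"
      using Linf_AE[OF T u[unfolded True]] Linf_AE[OF T v[unfolded True]]
      by eventually_elim (rule norm_triangle_mono)
    then show ?thesis using Linf_I[OF T m] True by blast
  next
    case False
    let ?r = "enn2real q" and ?M = "lebesgue_on {0..T}"
    have r: "1 \<le> ?r" by (rule enn2real_ge_1[OF q False])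
    have bound: "integrable ?M (\<lambda>t. (norm (u t + v t) / (a + b)) powr ?r) \<and>
        Lq_norm T q (\<lambda>t. u t + v t) \<le> a + b"
      if a: "Lq_norm T q u \<le> a" "0 < a" and b: "Lq_norm T q v \<le> b" "0 < b" for a b
    proof -
      let ?g = "\<lambda>t. a / (a + b) * (norm (u t) / a) powr ?r + b / (a + b) * (norm (v t) / b) powr ?r"
      have le: "(norm (u t + v t) / (a + b)) powr ?r \<le> ?g t" for t
      proof -
        have "(norm (u t + v t) / (a + b)) powr ?r \<le>
            (a / (a + b) * (norm (u t) / a) + b / (a + b) * (norm (v t) / b)) powr ?r"
        proof (rule powr_mono2)
          have "norm (u t + v t) / (a + b) \<le> (norm (u t) + norm (v t)) / (a + b)"
            using a(2) b(2) by (intro divide_right_mono norm_triangle_ineq) auto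
          then show "norm (u t + v t) / (a + b) \<le>
              a / (a + b) * (norm (u t) / a) + b / (a + b) * (norm (v t) / b)"
            using a(2) b(2) by (simp add: add_divide_distrib)
        qed (use r a b in auto)
        also have "\<dots> \<le> ?g t"
          by (rule powr_convex_combination[OF r])
             (use a(2) b(2) in \<open>auto simp: add_divide_distrib[symmetric]\<close>)
        finally show ?thesis .
      qed
      note ui = Lq_scaled_integrable[OF q False a(2) u] and vi = Lq_scaled_integrable[OF q False b(2) v]
      have gi: "integrable ?M ?g"
        using ui vi by (intro Bochner_Integration.integrable_add integrable_mult_right)
      have si: "integrable ?M (\<lambda>t. (norm (u t + v t) / (a + b)) powr ?r)"
        by (rule Bochner_Integration.integrable_bound[OF gi], measurable)
           (use le in \<open>auto intro: order_trans[OF _ abs_ge_self]\<close>)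
      have "(\<integral>t. (norm (u t + v t) / (a + b)) powr ?r \<partial>?M) \<le> (\<integral>t. ?g t \<partial>?M)"
        by (rule integral_mono[OF si gi le])
      also have "\<dots> = a / (a + b) * (\<integral>t. (norm (u t) / a) powr ?r \<partial>?M)
          + b / (a + b) * (\<integral>t. (norm (v t) / b) powr ?r \<partial>?M)"
        using ui vi by (subst Bochner_Integration.integral_add) auto
      also have "\<dots> \<le> a / (a + b) * 1 + b / (a + b) * 1"
        using a b Lq_norm_le_iff[OF q False a(2), of T u] Lq_norm_le_iff[OF q False b(2), of T v]
        by (intro add_mono mult_left_mono) auto
      also have "\<dots> = 1" using a(2) b(2) by (simp add: add_divide_distrib[symmetric])
      finally have "Lq_norm T q (\<lambda>t. u t + v t) \<le> a + b"
        using Lq_norm_le_iff[OF q False, of "a + b" T "\<lambda>t. u t + v t"] a(2) b(2) by simp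
      then show ?thesis using si by blast
    qed
    note nn = Lq_norm_nonneg[OF T, of q u] Lq_norm_nonneg[OF T, of q v]
    have "Lq_norm T q (\<lambda>t. u t + v t) \<le> Lq_norm T q u + Lq_norm T q v"
    proof (rule field_le_epsilon)
      fix e :: real assume "0 < e"
      then show "Lq_norm T q (\<lambda>t. u t + v t) \<le> Lq_norm T q u + Lq_norm T q v + e"
        using bound[of "Lq_norm T q u + e / 2" "Lq_norm T q v + e / 2"] nn by simp
    qed
    moreover have "integrable ?M (\<lambda>t. norm (u t + v t) powr ?r)"
    proof -
      define c where "c = Lq_norm T q u + 1 + (Lq_norm T q v + 1)"
      have c: "c > 0" using nn by (simp add: c_def)
      have "integrable ?M (\<lambda>t. (norm (u t + v t) / c) powr ?r)"
        using bound[of "Lq_norm T q u + 1" "Lq_norm T q v + 1"] nn by (simp add: c_def)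
      then have "integrable ?M (\<lambda>t. c powr ?r * (norm (u t + v t) / c) powr ?r)"
        by simp
      then show ?thesis using c by (simp add: powr_divide)
    qed
    ultimately show ?thesis using m False by (simp add: Lq_finite)
  qed
  then show "(\<lambda>t. u t + v t) \<in> Lq_space T q"
    "Lq_norm T q (\<lambda>t. u t + v t) \<le> Lq_norm T q u + Lq_norm T q v" by auto
qed

lemma Lq_norm_minus_commute: "Lq_norm T q (\<lambda>t. u t - v t) = Lq_norm T q (\<lambda>t. v t - u t)"
  unfolding Lq_norm_def by (simp add: norm_minus_commute)

lemma Lq_diff:
  fixes u v :: "real \<Rightarrow> 'a::euclidean_space"
  assumes T: "0 < T" and q: "1 \<le> q" and u: "u \<in> Lq_space T q" and v: "v \<in> Lq_space T q"
  shows "(\<lambda>t. u t - v t) \<in> Lq_space T q"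
    "Lq_norm T q (\<lambda>t. u t - v t) \<le> Lq_norm T q u + Lq_norm T q v"
  using Lq_add[OF T q u Lq_scaleR(1)[OF T q v, of "-1"]] Lq_scaleR(2)[OF T q v, of "-1"] by auto

section \<open>Comparison of exponents on a finite interval\<close>

lemma integral_const_interval:
  assumes "0 < T"
  shows "integrable (lebesgue_on {0..T}) (\<lambda>t. c::real)" "(\<integral>t. c \<partial>lebesgue_on {0..T}) = c * T"
  using assms by (auto simp: measure_restrict_space)

text \<open>In place of Hoelder's inequality, a power with the smaller exponent is bounded by 1 plus
  the power with the larger one. For a normalised function the integral is then at most T + 1, which
  is where this crude constant comes from.\<close>

lemma Lq_embedding:
  fixes u :: "real \<Rightarrow> 'a::euclidean_space"
  assumes T: "0 < T" and p: "1 \<le> p" and pq: "p \<le> q" and u: "u \<in> Lq_space T q"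
  shows "u \<in> Lq_space T p" "Lq_norm T p u \<le> (T + 1) * Lq_norm T q u"
proof -
  note m [measurable] = Lq_space_measurable[OF u]
  let ?r = "enn2real p" and ?M = "lebesgue_on {0..T}"
  have q: "1 \<le> q" using p pq by (rule order_trans)
  note nn = Lq_norm_nonneg[OF T, of q u]
  have "u \<in> Lq_space T p \<and> Lq_norm T p u \<le> (T + 1) * Lq_norm T q u"
  proof (cases "p = \<infinity>")
    case True
    then have "q = \<infinity>" using pq by (simp add: top_unique)
    then show ?thesis using u True mult_right_mono[OF _ nn, of 1 "T+1"] T by simp
  next
    case False
    have r: "1 \<le> ?r" by (rule enn2real_ge_1[OF p False])
    have bound: "integrable ?M (\<lambda>t. (norm (u t) / N) powr ?r) \<and>
       Lq_norm T p u \<le> (T + 1) * N" if N: "Lq_norm T q u \<le> N" "0 < N" for N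
    proof -
      have "\<exists>g. integrable ?M g \<and> (\<integral>t. g t \<partial>?M) \<le> T + 1 \<and>
          (AE t in ?M. (norm (u t) / N) powr ?r \<le> g t)"
      proof (cases "q = \<infinity>")
        case True
        have "AE t in ?M. (norm (u t) / N) powr ?r \<le> 1"
          using Linf_AE[OF T u[unfolded True]]
        proof eventually_elim
          case (elim t)
          then have "norm (u t) / N \<le> 1" using N True by simp
          then show ?case using powr_mono2[of ?r "norm (u t) / N" 1] r N by simp
        qed
        then show ?thesis
          using integral_const_interval[OF T, of 1] by (intro exI[of _ "\<lambda>t. 1"]) auto
      next
        case qf: False
        let ?s = "enn2real q"
        have rs: "?r \<le> ?s" using pq qf by (intro enn2real_mono) (auto simp: less_top)
        note ui = Lq_scaled_integrable[OF q qf N(2) u]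
        have "(norm (u t) / N) powr ?r \<le> 1 + (norm (u t) / N) powr ?s" for t
        proof (cases "norm (u t) / N \<le> 1")
          case True
          then have "(norm (u t) / N) powr ?r \<le> 1"
            using powr_mono2[of ?r "norm (u t) / N" 1] r N by simp
          then show ?thesis by (simp add: add_increasing2)
        next
          case False
          then have "(norm (u t) / N) powr ?r \<le> (norm (u t) / N) powr ?s"
            using rs by (intro powr_mono) auto
          then show ?thesis by simp
        qed
        moreover have "(\<integral>t. 1 + (norm (u t) / N) powr ?s \<partial>?M) \<le> T + 1"
          using ui integral_const_interval[OF T, of 1] Lq_norm_le_iff[OF q qf N(2), of T u] N
          by (subst Bochner_Integration.integral_add) auto
        ultimately show ?thesis
          using ui integral_const_interval(1)[OF T, of 1]
          by (intro exI[of _ "\<lambda>t. 1 + (norm (u t) / N) powr ?s"]) auto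
      qed
      then obtain g where gi: "integrable ?M g" and g1: "(\<integral>t. g t \<partial>?M) \<le> T + 1"
        and gle: "AE t in ?M. (norm (u t) / N) powr ?r \<le> g t" by blast
      have si: "integrable ?M (\<lambda>t. (norm (u t) / N) powr ?r)"
        by (rule Bochner_Integration.integrable_bound[OF gi], measurable)
           (use gle in \<open>eventually_elim, auto intro: order_trans[OF _ abs_ge_self]\<close>)
      have le: "(\<integral>t. (norm (u t) / N) powr ?r \<partial>?M) \<le> T + 1"
        using integral_mono_AE[OF si gi gle] g1 by linarith
      \<comment> \<open>Enlarging the scale by T + 1 divides the integral by (T + 1) powr r, which
        is at least T + 1 because r \<ge> 1.\<close>
      have "(\<integral>t. (norm (u t) / ((T + 1) * N)) powr ?r \<partial>?M)
          = (\<integral>t. (norm (u t) / N) powr ?r \<partial>?M) / (T + 1) powr ?r"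
      proof -
        have "(norm (u t) / ((T + 1) * N)) powr ?r = (norm (u t) / N) powr ?r / (T + 1) powr ?r" for t
          using T N by (simp add: powr_divide powr_mult)
        then show ?thesis by simp
      qed
      also have "\<dots> \<le> (T + 1) / (T + 1) powr ?r"
        using le by (intro divide_right_mono) auto
      also have "\<dots> \<le> 1"
        using T r powr_mono[of 1 ?r "T + 1"] by simp
      finally have "Lq_norm T p u \<le> (T + 1) * N"
        using Lq_norm_le_iff[OF p False, of "(T + 1) * N" T u] T N by simp
      then show ?thesis using si by blast
    qed
    have "Lq_norm T p u \<le> (T + 1) * Lq_norm T q u"
    proof (rule field_le_epsilon)
      fix e :: real assume "0 < e"
      then show "Lq_norm T p u \<le> (T + 1) * Lq_norm T q u + e"
        using bound[of "Lq_norm T q u + e / (T + 1)"] nn T by (simp add: distrib_left add_nonneg_pos)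
    qed
    moreover have "integrable ?M (\<lambda>t. norm (u t) powr ?r)"
    proof -
      define c where "c = Lq_norm T q u + 1"
      have c: "c > 0" using nn by (simp add: c_def)
      have "integrable ?M (\<lambda>t. (norm (u t) / c) powr ?r)"
        using bound[of c] nn by (simp add: c_def)
      then have "integrable ?M (\<lambda>t. c powr ?r * (norm (u t) / c) powr ?r)" by simp
      then show ?thesis using c by (simp add: powr_divide)
    qed
    ultimately show ?thesis using m False by (simp add: Lq_finite)
  qed
  then show "u \<in> Lq_space T p" "Lq_norm T p u \<le> (T + 1) * Lq_norm T q u" by auto
qed

lemma L1_space_iff:
  "u \<in> Lq_space T 1 \<longleftrightarrow> integrable (lebesgue_on {0..T}) u"
  by (auto simp: Lq_space_def integrable_norm_iff)

lemma L1_norm_eq: "Lq_norm T 1 u = (\<integral>t. norm (u t) \<partial>lebesgue_on {0..T})"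
  by (simp add: Lq_norm_def)

lemma Lq_integrable:
  fixes u :: "real \<Rightarrow> 'a::euclidean_space"
  assumes "0 < T" "1 \<le> q" "u \<in> Lq_space T q"
  shows "integrable (lebesgue_on {0..T}) u"
    "(\<integral>t. norm (u t) \<partial>lebesgue_on {0..T}) \<le> (T + 1) * Lq_norm T q u"
  using Lq_embedding[OF assms(1) _ assms(2,3)] by (auto simp: L1_space_iff L1_norm_eq)


subsection \<open>Absolutely continuous functions and linear differential equations\<close>

text \<open>The norm of a matrix is here the Euclidean norm of all its entries, so Cauchy-Schwarz in
  each row suffices.\<close>

lemma norm_matrix_vector_le:
  fixes M :: "real ^ 'n::finite ^ 'm::finite"
  shows "norm (M *v x) \<le> norm M * norm x"
proof -
  have "norm (M *v x) = L2_set (\<lambda>i. norm ((M *v x) $ i)) UNIV"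
    by (rule norm_vec_def)
  also have "\<dots> \<le> L2_set (\<lambda>i. norm (M $ i) * norm x) UNIV"
    by (rule L2_set_mono)
       (auto simp: matrix_vector_mul_component intro: Cauchy_Schwarz_ineq2)
  also have "\<dots> = norm M * norm x"
    by (simp add: L2_set_left_distrib norm_vec_def)
  finally show ?thesis .
qed

section \<open>Absolute continuity: continuity and linear combinations\<close>

lemma absolutely_continuous_funE:
  assumes "absolutely_continuous_fun T x" "0 < e"
  obtains \<delta> where "\<delta> > 0" "\<And>(n::nat) a b. (\<forall>i<n. 0 \<le> a i \<and> a i \<le> b i \<and> b i \<le> T) \<Longrightarrow>
        (\<forall>i<n. \<forall>j<n. i \<noteq> j \<longrightarrow> {a i<..<b i} \<inter> {a j<..<b j} = {}) \<Longrightarrow>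
        (\<Sum>i<n. b i - a i) < \<delta> \<Longrightarrow> (\<Sum>i<n. norm (x (b i) - x (a i))) < e"
proof -
  from assms(1)[unfolded absolutely_continuous_fun_def, THEN spec, THEN mp, OF assms(2)]
  obtain \<delta> where \<delta>: "0 < \<delta> \<and> (\<forall>(n::nat) a b. (\<forall>i<n. 0 \<le> a i \<and> a i \<le> b i \<and> b i \<le> T) \<longrightarrow>
        (\<forall>i<n. \<forall>j<n. i \<noteq> j \<longrightarrow> {a i<..<b i} \<inter> {a j<..<b j} = {}) \<longrightarrow>
        (\<Sum>i<n. b i - a i) < \<delta> \<longrightarrow> (\<Sum>i<n. norm (x (b i) - x (a i))) < e)"
    by (rule exE)
  show thesis
    by (rule that[OF \<delta>[THEN conjunct1]])
       (rule \<delta>[THEN conjunct2, THEN spec, THEN spec, THEN spec, THEN mp, THEN mp, THEN mp])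
qed

lemma absolutely_continuous_fun_continuous_on:
  assumes "absolutely_continuous_fun T x"
  shows "continuous_on {0..T} x"
  unfolding continuous_on_iff
proof (intro ballI allI impI)
  fix t e :: real assume t: "t \<in> {0..T}" and e: "0 < e"
  obtain \<delta> where \<delta>: "\<delta> > 0" and ac: "\<And>(n::nat) a b. (\<forall>i<n. 0 \<le> a i \<and> a i \<le> b i \<and> b i \<le> T) \<Longrightarrow>
        (\<forall>i<n. \<forall>j<n. i \<noteq> j \<longrightarrow> {a i<..<b i} \<inter> {a j<..<b j} = {}) \<Longrightarrow>
        (\<Sum>i<n. b i - a i) < \<delta> \<Longrightarrow> (\<Sum>i<n. norm (x (b i) - x (a i))) < e"
    by (rule absolutely_continuous_funE[OF assms e], rule that, assumption)
  have "dist (x s) (x t) < e" if s: "s \<in> {0..T}" "dist s t < \<delta>" for s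
  proof -
    \<comment> \<open>A family of one interval; max and min put its endpoints in order.\<close>
    have "(\<Sum>i<(1::nat). norm (x (max s t) - x (min s t))) < e"
      by (rule ac) (use s t in \<open>auto simp: dist_real_def\<close>)
    then show ?thesis
      by (cases "s \<le> t") (auto simp: dist_norm norm_minus_commute)
  qed
  then show "\<exists>d>0. \<forall>s\<in>{0..T}. dist s t < d \<longrightarrow> dist (x s) (x t) < e"
    using \<delta> by blast
qed

lemma absolutely_continuous_fun_scaleR:
  assumes "absolutely_continuous_fun T x"
  shows "absolutely_continuous_fun T (\<lambda>t. c *\<^sub>R x t)"
  unfolding absolutely_continuous_fun_def
proof (intro allI impI)
  fix e :: real assume e: "0 < e"
  \<comment> \<open>The added 1 covers c = 0.\<close>
  have e': "0 < e / (\<bar>c\<bar> + 1)" using e by simp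
  obtain \<delta> where \<delta>: "\<delta> > 0" and ac: "\<And>(n::nat) a b. (\<forall>i<n. 0 \<le> a i \<and> a i \<le> b i \<and> b i \<le> T) \<Longrightarrow>
        (\<forall>i<n. \<forall>j<n. i \<noteq> j \<longrightarrow> {a i<..<b i} \<inter> {a j<..<b j} = {}) \<Longrightarrow>
        (\<Sum>i<n. b i - a i) < \<delta> \<Longrightarrow> (\<Sum>i<n. norm (x (b i) - x (a i))) < e / (\<bar>c\<bar> + 1)"
    by (rule absolutely_continuous_funE[OF assms e'], rule that, assumption)
  have "(\<Sum>i<n. norm (c *\<^sub>R x (b i) - c *\<^sub>R x (a i))) < e"
    if "\<forall>i<n. 0 \<le> a i \<and> a i \<le> b i \<and> b i \<le> T"
      "\<forall>i<n. \<forall>j<n. i \<noteq> j \<longrightarrow> {a i<..<b i} \<inter> {a j<..<b j} = {}"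
      "(\<Sum>i<n. b i - a i) < \<delta>" for n :: nat and a b
  proof -
    let ?S = "\<Sum>i<n. norm (x (b i) - x (a i))"
    have S: "?S < e / (\<bar>c\<bar> + 1)" "0 \<le> ?S" using ac[OF that] by (auto intro: sum_nonneg)
    have "(\<Sum>i<n. norm (c *\<^sub>R x (b i) - c *\<^sub>R x (a i))) = \<bar>c\<bar> * ?S"
      by (simp add: scaleR_diff_right[symmetric] sum_distrib_left)
    also have "\<dots> \<le> (\<bar>c\<bar> + 1) * ?S" using S(2) by (intro mult_right_mono) auto
    also have "\<dots> < e" using S(1) by (simp add: field_simps)
    finally show ?thesis .
  qed
  then show "\<exists>\<delta>>0. \<forall>(n::nat) a b. (\<forall>i<n. 0 \<le> a i \<and> a i \<le> b i \<and> b i \<le> T) \<longrightarrow>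
        (\<forall>i<n. \<forall>j<n. i \<noteq> j \<longrightarrow> {a i<..<b i} \<inter> {a j<..<b j} = {}) \<longrightarrow>
        (\<Sum>i<n. b i - a i) < \<delta> \<longrightarrow> (\<Sum>i<n. norm (c *\<^sub>R x (b i) - c *\<^sub>R x (a i))) < e"
    using \<delta> by (intro exI[of _ \<delta>]) simp
qed

lemma absolutely_continuous_fun_add:
  assumes "absolutely_continuous_fun T x" "absolutely_continuous_fun T y"
  shows "absolutely_continuous_fun T (\<lambda>t. x t + y t)"
  unfolding absolutely_continuous_fun_def
proof (intro allI impI)
  fix e :: real assume "0 < e"
  then have e: "0 < e / 2" by simp
  obtain \<delta>1 where \<delta>1: "\<delta>1 > 0" and ac1: "\<And>(n::nat) a b. (\<forall>i<n. 0 \<le> a i \<and> a i \<le> b i \<and> b i \<le> T) \<Longrightarrow>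
        (\<forall>i<n. \<forall>j<n. i \<noteq> j \<longrightarrow> {a i<..<b i} \<inter> {a j<..<b j} = {}) \<Longrightarrow>
        (\<Sum>i<n. b i - a i) < \<delta>1 \<Longrightarrow> (\<Sum>i<n. norm (x (b i) - x (a i))) < e / 2"
    by (rule absolutely_continuous_funE[OF assms(1) e], rule that, assumption)
  obtain \<delta>2 where \<delta>2: "\<delta>2 > 0" and ac2: "\<And>(n::nat) a b. (\<forall>i<n. 0 \<le> a i \<and> a i \<le> b i \<and> b i \<le> T) \<Longrightarrow>
        (\<forall>i<n. \<forall>j<n. i \<noteq> j \<longrightarrow> {a i<..<b i} \<inter> {a j<..<b j} = {}) \<Longrightarrow>
        (\<Sum>i<n. b i - a i) < \<delta>2 \<Longrightarrow> (\<Sum>i<n. norm (y (b i) - y (a i))) < e / 2"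
    by (rule absolutely_continuous_funE[OF assms(2) e], rule that, assumption)
  have "(\<Sum>i<n. norm (x (b i) + y (b i) - (x (a i) + y (a i)))) < e"
    if "\<forall>i<n. 0 \<le> a i \<and> a i \<le> b i \<and> b i \<le> T"
      "\<forall>i<n. \<forall>j<n. i \<noteq> j \<longrightarrow> {a i<..<b i} \<inter> {a j<..<b j} = {}"
      "(\<Sum>i<n. b i - a i) < min \<delta>1 \<delta>2" for n :: nat and a b
  proof -
    have "(\<Sum>i<n. norm (x (b i) + y (b i) - (x (a i) + y (a i)))) \<le>
        (\<Sum>i<n. norm (x (b i) - x (a i)) + norm (y (b i) - y (a i)))"
      by (intro sum_mono) (simp add: add_diff_add norm_triangle_ineq)
    also have "\<dots> < e"
      using ac1[OF that(1,2)] ac2[OF that(1,2)] that(3) by (simp add: sum.distrib)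
    finally show ?thesis .
  qed
  then show "\<exists>\<delta>>0. \<forall>(n::nat) a b. (\<forall>i<n. 0 \<le> a i \<and> a i \<le> b i \<and> b i \<le> T) \<longrightarrow>
        (\<forall>i<n. \<forall>j<n. i \<noteq> j \<longrightarrow> {a i<..<b i} \<inter> {a j<..<b j} = {}) \<longrightarrow>
        (\<Sum>i<n. b i - a i) < \<delta> \<longrightarrow>
        (\<Sum>i<n. norm (x (b i) + y (b i) - (x (a i) + y (a i)))) < e"
    using \<delta>1 \<delta>2 by (intro exI[of _ "min \<delta>1 \<delta>2"]) simp
qed

lemma absolutely_continuous_fun_diff:
  assumes "absolutely_continuous_fun T x" "absolutely_continuous_fun T y"
  shows "absolutely_continuous_fun T (\<lambda>t. x t - y t)"
  using absolutely_continuous_fun_add[OF assms(1) absolutely_continuous_fun_scaleR[OF assms(2), of "-1"]]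
  by simp

text \<open>Passage from almost-everywhere statements to the negligible sets of the gauge integral,
  in which the differential equation is integrated.\<close>

lemma AE_lebesgue_on_negligible:
  fixes S :: "real set"
  assumes "S \<in> sets lebesgue"
  shows "(AE t in lebesgue_on S. P t) \<longleftrightarrow> negligible {t \<in> S. \<not> P t}"
proof -
  have "(AE t in lebesgue_on S. P t) \<longleftrightarrow> (AE t in lebesgue. t \<in> S \<longrightarrow> P t)"
    using assms by (intro AE_restrict_space_iff) simp
  also have "\<dots> \<longleftrightarrow> {t \<in> S. \<not> P t} \<in> null_sets lebesgue"
    by (simp add: completion.AE_iff_null_sets)
  finally show ?thesis by (simp add: negligible_iff_null_sets)
qed

text \<open>Completeness of Lebesgue measure, applied to the extensions by 0 to the whole
  line.\<close>

lemma borel_measurable_lebesgue_on_AE_cong: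
  fixes u v :: "real \<Rightarrow> 'a::euclidean_space"
  assumes "u \<in> borel_measurable (lebesgue_on S)" "S \<in> sets lebesgue"
    "AE t in lebesgue_on S. u t = v t"
  shows "v \<in> borel_measurable (lebesgue_on S)"
proof -
  have "(\<lambda>t. if t \<in> S then u t else 0) \<in> borel_measurable lebesgue"
    using borel_measurable_if_I[OF assms(1,2)] .
  moreover have "AE t in lebesgue. (if t \<in> S then u t else 0) = (if t \<in> S then v t else 0)"
    using assms(2,3) by (subst (asm) AE_restrict_space_iff) (auto elim: eventually_mono)
  ultimately have "(\<lambda>t. if t \<in> S then v t else 0) \<in> borel_measurable lebesgue"
    by (rule borel_measurable_AE)
  then show ?thesis by (rule borel_measurable_if_D)
qed

text \<open>Tags outside the null set \<open>N\<close> are handled by differentiability; the intervals tagged in \<open>N\<close> have small total length because the indicator of \<open>N\<close> has integral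
  zero, and there absolute continuity applies.\<close>

lemma absolutely_continuous_fun_has_integral:
  fixes x g :: "real \<Rightarrow> 'a::euclidean_space"
  assumes ac: "absolutely_continuous_fun T x"
    and deriv: "AE t in lebesgue_on {0..T}. (x has_vector_derivative g t) (at t within {0..T})"
    and ab: "0 \<le> a" "a \<le> b" "b \<le> T"
  shows "(g has_integral (x b - x a)) {a..b}"
proof -
  define N where "N = {t \<in> {0..T}. \<not> (x has_vector_derivative g t) (at t within {0..T})}"
  have N: "negligible N"
    using deriv by (simp add: AE_lebesgue_on_negligible N_def)
  \<comment> \<open>With value 0 on N, a tag in N contributes only the increment of x over its
    interval, which absolute continuity controls.\<close>
  define g' where "g' t = (if t \<in> N then 0 else g t)" for t
  have "(g' has_integral (x b - x a)) {a..b}"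
    unfolding has_integral_real
  proof (intro allI impI)
    fix e :: real assume e: "0 < e"
    \<comment> \<open>The differentiable tags may cost e / 2 in total; the 1 keeps the denominator
      positive and the bound strict.\<close>
    define e1 where "e1 = e / 2 / (b - a + 1)"
    have e1: "e1 > 0" "e1 * (b - a) < e / 2" using e ab by (auto simp: e1_def field_simps)
    obtain \<delta> where \<delta>: "\<delta> > 0" and small: "\<And>(n::nat) a b.
        (\<forall>i<n. 0 \<le> a i \<and> a i \<le> b i \<and> b i \<le> T) \<Longrightarrow>
        (\<forall>i<n. \<forall>j<n. i \<noteq> j \<longrightarrow> {a i<..<b i} \<inter> {a j<..<b j} = {}) \<Longrightarrow>
        (\<Sum>i<n. b i - a i) < \<delta> \<Longrightarrow> (\<Sum>i<n. norm (x (b i) - x (a i))) < e / 2"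
      by (rule absolutely_continuous_funE[OF ac half_gt_zero[OF e]], rule that, assumption)
    have "\<exists>r>0. \<forall>s\<in>{0..T}. \<bar>s - t\<bar> < r \<longrightarrow> norm (x s - x t - (s - t) *\<^sub>R g t) \<le> e1 * \<bar>s - t\<bar>"
      if "t \<in> {0..T}" "t \<notin> N" for t
      using that e1(1) by (auto simp: N_def has_vector_derivative_def has_derivative_within_alt)
    then obtain r where r: "\<And>t. t \<in> {0..T} \<Longrightarrow> t \<notin> N \<Longrightarrow> r t > 0"
      "\<And>t s. t \<in> {0..T} \<Longrightarrow> t \<notin> N \<Longrightarrow> s \<in> {0..T} \<Longrightarrow> \<bar>s - t\<bar> < r t \<Longrightarrow>
         norm (x s - x t - (s - t) *\<^sub>R g t) \<le> e1 * \<bar>s - t\<bar>"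
      by metis
    define \<gamma>1 where "\<gamma>1 t = ball t (if t \<in> {0..T} \<and> t \<notin> N then r t else 1)" for t
    have \<gamma>1: "gauge \<gamma>1" using r(1) by (auto simp: gauge_def \<gamma>1_def)
    have "((indicator N :: real \<Rightarrow> real) has_integral 0) {a..b}"
      using N unfolding negligible_def by (metis box_real(2))
    then obtain \<gamma>2 where \<gamma>2: "gauge \<gamma>2" and g2: "\<And>\<D>. \<D> tagged_division_of {a..b} \<Longrightarrow> \<gamma>2 fine \<D> \<Longrightarrow>
        norm ((\<Sum>(t, K)\<in>\<D>. measure lborel K *\<^sub>R (indicator N t :: real)) - 0) < \<delta>"
      using \<delta> unfolding has_integral_real by meson
    have "norm ((\<Sum>(t, K)\<in>\<D>. measure lborel K *\<^sub>R g' t) - (x b - x a)) < e"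
      if \<D>: "\<D> tagged_division_of {a..b}" and fine: "(\<lambda>t. \<gamma>1 t \<inter> \<gamma>2 t) fine \<D>" for \<D>
    proof -
      note td = tagged_division_ofD[OF \<D>]
      have K: "K = {Inf K..Sup K} \<and> Inf K \<le> t \<and> t \<le> Sup K \<and> a \<le> Inf K \<and> Sup K \<le> b \<and>
          measure lborel K = Sup K - Inf K" if tK: "(t, K) \<in> \<D>" for t K
      proof -
        obtain l u where lu: "K = {l..u}" using td(4)[OF tK] by auto
        have "t \<in> K" "K \<subseteq> {a..b}" using td(2,3)[OF tK] by auto
        then show ?thesis unfolding lu by auto
      qed
      let ?D1 = "{p \<in> \<D>. fst p \<notin> N}" and ?D2 = "{p \<in> \<D>. fst p \<in> N}"
      define hh where "hh p = measure lborel (snd p) *\<^sub>R g' (fst p) - (x (Sup (snd p)) - x (Inf (snd p)))"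
        for p
      have fin: "finite ?D1" "finite ?D2" using td(1) by auto
      have "(\<Sum>(t, K)\<in>\<D>. measure lborel K *\<^sub>R g' t) - (x b - x a) = sum hh \<D>"
        using additive_tagged_division_1[OF ab(2) \<D>, of x]
        by (simp add: hh_def sum_subtractf case_prod_beta)
      also have "\<dots> = sum hh ?D1 + sum hh ?D2"
      proof -
        have "sum hh (?D1 \<union> ?D2) = sum hh ?D1 + sum hh ?D2"
          by (rule sum.union_disjoint[OF fin]) auto
        moreover have "?D1 \<union> ?D2 = \<D>" by auto
        ultimately show ?thesis by simp
      qed
      finally have eq: "(\<Sum>(t, K)\<in>\<D>. measure lborel K *\<^sub>R g' t) - (x b - x a)
          = sum hh ?D1 + sum hh ?D2" .
      have split: "norm ((\<Sum>(t, K)\<in>\<D>. measure lborel K *\<^sub>R g' t) - (x b - x a))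
          \<le> (\<Sum>p\<in>?D1. norm (hh p)) + (\<Sum>p\<in>?D2. norm (hh p))"
        unfolding eq using norm_triangle_ineq[of "sum hh ?D1" "sum hh ?D2"] norm_sum[of hh ?D1] norm_sum[of hh ?D2]
        by linarith
      have "(\<Sum>p\<in>?D1. norm (hh p)) \<le> (\<Sum>p\<in>?D1. e1 * measure lborel (snd p))"
      proof (rule sum_mono)
        fix p assume "p \<in> ?D1"
        then obtain t L where p: "p = (t, L)" "(t, L) \<in> \<D>" "t \<notin> N" by (cases p) auto
        define l u where "l = Inf L" and "u = Sup L"
        have L: "L = {l..u}" "l \<le> t" "t \<le> u" "a \<le> l" "u \<le> b" "measure lborel L = u - l"
          using K[OF p(2)] by (auto simp: l_def u_def)
        have t: "t \<in> {0..T}" "l \<in> {0..T}" "u \<in> {0..T}" using L ab by auto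
        have "L \<subseteq> \<gamma>1 t" using fine p(2) by (auto simp: fine_def)
        moreover have "\<gamma>1 t = ball t (r t)" using t(1) p(3) by (simp add: \<gamma>1_def)
        moreover have "l \<in> L" "u \<in> L" using L by auto
        ultimately have "l \<in> ball t (r t)" "u \<in> ball t (r t)" by blast+
        then have "\<bar>l - t\<bar> < r t" "\<bar>u - t\<bar> < r t" by (auto simp: dist_real_def)
        then have lu: "norm (x l - x t - (l - t) *\<^sub>R g t) \<le> e1 * (t - l)"
          "norm (x u - x t - (u - t) *\<^sub>R g t) \<le> e1 * (u - t)"
          using r(2)[OF t(1) p(3) t(2)] r(2)[OF t(1) p(3) t(3)] L by auto
        have "hh p = (u - l) *\<^sub>R g t - (x u - x l)"
          using p(3) L(6) by (simp add: hh_def p(1) g'_def l_def u_def)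
        \<comment> \<open>Straddle argument: the tag lies between l and u, so the two one-sided
          errors are proportional to t - l and u - t, and these add up to the length.\<close>
        then have eq: "hh p = (x l - x t - (l - t) *\<^sub>R g t) - (x u - x t - (u - t) *\<^sub>R g t)"
          by (simp add: algebra_simps)
        have "norm (hh p) \<le> e1 * (t - l) + e1 * (u - t)"
          unfolding eq by (rule order_trans[OF norm_triangle_ineq4 add_mono[OF lu]])
        then show "norm (hh p) \<le> e1 * measure lborel (snd p)"
          unfolding p(1) snd_conv L(6) by (simp add: algebra_simps)
      qed
      also have "\<dots> \<le> (\<Sum>p\<in>\<D>. e1 * measure lborel (snd p))"
        using td(1) e1(1) by (intro sum_mono2) auto
      also have "\<dots> = e1 * (b - a)"
        using additive_content_tagged_division[of \<D> a b] \<D> ab(2)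
        by (simp add: sum_distrib_left[symmetric] case_prod_beta)
      finally have D1: "(\<Sum>p\<in>?D1. norm (hh p)) < e / 2" using e1(2) by linarith
      have "(\<Sum>p\<in>?D2. norm (hh p)) < e / 2"
      proof -
        \<comment> \<open>Absolute continuity speaks of families indexed by initial segments of the
          naturals, hence the enumeration.\<close>
        obtain f where f: "bij_betw f {..<card ?D2} ?D2"
          using ex_bij_betw_nat_finite[OF fin(2)] by (auto simp: lessThan_atLeast0)
        let ?l = "\<lambda>i. Inf (snd (f i))" and ?u = "\<lambda>i. Sup (snd (f i))"
        have fD: "f i \<in> \<D> \<and> fst (f i) \<in> N" if "i < card ?D2" for i
          using bij_betwE[OF f] that by blast
        have Ki: "snd (f i) = {?l i..?u i} \<and> ?l i \<le> ?u i \<and> a \<le> ?l i \<and> ?u i \<le> b \<and>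
            measure lborel (snd (f i)) = ?u i - ?l i" if "i < card ?D2" for i
          using K[of "fst (f i)" "snd (f i)"] fD[OF that] by simp
        have "(\<Sum>p\<in>?D2. norm (hh p)) = (\<Sum>p\<in>?D2. norm (x (Sup (snd p)) - x (Inf (snd p))))"
          by (rule sum.cong) (auto simp: hh_def g'_def norm_minus_commute)
        also have "\<dots> = (\<Sum>i<card ?D2. norm (x (?u i) - x (?l i)))"
          by (rule sum.reindex_bij_betw[OF f, symmetric])
        also have "\<dots> < e / 2"
        proof (rule small)
          show "\<forall>i<card ?D2. 0 \<le> ?l i \<and> ?l i \<le> ?u i \<and> ?u i \<le> T"
            using Ki ab by fastforce
          show "\<forall>i<card ?D2. \<forall>j<card ?D2. i \<noteq> j \<longrightarrow> {?l i<..<?u i} \<inter> {?l j<..<?u j} = {}"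
          proof (intro allI impI)
            fix i j assume ij: "i < card ?D2" "j < card ?D2" "i \<noteq> j"
            then have "f i \<noteq> f j"
              using f by (auto simp: bij_betw_def inj_on_def)
            then have "interior (snd (f i)) \<inter> interior (snd (f j)) = {}"
              using td(5)[of "fst (f i)" "snd (f i)" "fst (f j)" "snd (f j)"] fD ij by simp
            moreover have "interior (snd (f i)) = {?l i<..<?u i}"
              using Ki[OF ij(1)] interior_atLeastAtMost_real by metis
            moreover have "interior (snd (f j)) = {?l j<..<?u j}"
              using Ki[OF ij(2)] interior_atLeastAtMost_real by metis
            ultimately show "{?l i<..<?u i} \<inter> {?l j<..<?u j} = {}" by simp
          qed
          have "(\<Sum>i<card ?D2. ?u i - ?l i) = (\<Sum>i<card ?D2. measure lborel (snd (f i)))"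
            using Ki by (intro sum.cong) auto
          also have "\<dots> = (\<Sum>p\<in>?D2. measure lborel (snd p))"
            by (rule sum.reindex_bij_betw[OF f])
          \<comment> \<open>The total length of the intervals tagged in N is the Riemann sum of the
            indicator of N, which \<open>\<gamma>2\<close> makes small.\<close>
          also have "\<dots> = (\<Sum>p\<in>\<D>. measure lborel (snd p) * indicator N (fst p))"
            by (rule sum.mono_neutral_cong_left) (use td(1) in auto)
          also have "\<dots> < \<delta>"
            using g2[OF \<D>] fine by (auto simp: fine_def case_prod_beta)
          finally show "(\<Sum>i<card ?D2. ?u i - ?l i) < \<delta>" .
        qed
        finally show ?thesis .
      qed
      then show ?thesis using split D1 by linarith
    qed
    then show "\<exists>\<gamma>. gauge \<gamma> \<and> (\<forall>\<D>. \<D> tagged_division_of {a..b} \<and> \<gamma> fine \<D> \<longrightarrow>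
        norm ((\<Sum>(t, K)\<in>\<D>. measure lborel K *\<^sub>R g' t) - (x b - x a)) < e)"
      using gauge_Int[OF \<gamma>1 \<gamma>2] by blast
  qed
  then show ?thesis
    by (rule has_integral_spike[OF N, rotated]) (simp add: g'_def)
qed

text \<open>The integrating factor makes \<open>F\<close> non-increasing: its derivative is exp (- a
  * s) * a times the difference of h s and its assumed upper bound.\<close>

lemma gronwall_integral:
  fixes h :: "real \<Rightarrow> real"
  assumes cont: "continuous_on {0..T} h" and a: "0 \<le> a"
    and le: "\<And>t. t \<in> {0..T} \<Longrightarrow> h t \<le> c + a * integral {0..t} h"
    and t: "t \<in> {0..T}"
  shows "h t \<le> c * exp (a * t)"
proof -
  define H where "H s = integral {0..s} h" for s
  define F where "F s = exp (- a * s) * (c + a * H s)" for s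
  have H: "(H has_vector_derivative h s) (at s within {0..T})" if "s \<in> {0..T}" for s
    unfolding H_def by (rule integral_has_vector_derivative[OF cont that])
  have "F t \<le> F 0"
  proof (rule DERIV_nonpos_imp_decreasing_open[where f = F and a = 0 and b = t])
    show "0 \<le> t" using t by simp
    have Hc: "continuous_on {0..T} H"
      using H has_vector_derivative_continuous continuous_on_eq_continuous_within by blast
    have "continuous_on {0..t} H"
      using t by (intro continuous_on_subset[OF Hc]) auto
    then show "continuous_on {0..t} F"
      unfolding F_def by (intro continuous_intros)
    fix s assume s: "0 < s" "s < t"
    have "(H has_vector_derivative h s) (at s)"
      using H[of s] s t by (simp add: at_within_Icc_at)
    then have "DERIV H s :> h s"
      by (simp add: has_real_derivative_iff_has_vector_derivative)
    then have "DERIV F s :> exp (- a * s) * (- a) * (c + a * H s) + exp (- a * s) * (a * h s)"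
      unfolding F_def by (auto intro!: derivative_eq_intros)
    moreover have "exp (- a * s) * (- a) * (c + a * H s) + exp (- a * s) * (a * h s)
        = exp (- a * s) * a * (h s - (c + a * H s))"
      by (simp add: algebra_simps)
    moreover have "\<dots> \<le> 0"
      using le[of s] s t a by (intro mult_nonneg_nonpos) (auto simp: H_def)
    ultimately show "\<exists>y. DERIV F s :> y \<and> y \<le> 0" by auto
  qed
  then have "exp (- a * t) * (c + a * H t) \<le> c" by (simp add: F_def H_def)
  then have "c + a * H t \<le> c * exp (a * t)"
    by (simp add: exp_minus field_simps)
  then show ?thesis using le[OF t] by (simp add: H_def)
qed

text \<open>Gronwall applied to the integrated equation. The control contributes its integral over
  the whole interval, so that the inhomogeneous term is a constant.\<close>

lemma linear_ode_bound:
  fixes h :: "real \<Rightarrow> real ^ 'd::finite" and w :: "real \<Rightarrow> real ^ 'm::finite"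
  assumes ac: "absolutely_continuous_fun T h"
    and ode: "AE t in lebesgue_on {0..T}.
       (h has_vector_derivative (A t *v h t + B t *v w t)) (at t within {0..T})"
    and A: "AE t in lebesgue_on {0..T}. norm (A t) \<le> a"
    and B: "AE t in lebesgue_on {0..T}. norm (B t) \<le> b"
    and w: "integrable (lebesgue_on {0..T}) w"
    and ab: "0 \<le> a" "0 \<le> b" and t: "t \<in> {0..T}"
  shows "norm (h t) \<le> (norm (h 0) + b * (\<integral>t. norm (w t) \<partial>lebesgue_on {0..T})) * exp (a * T)"
proof -
  let ?I = "\<integral>t. norm (w t) \<partial>lebesgue_on {0..T}"
  define g where "g t = A t *v h t + B t *v w t" for t
  define N where "N = {t \<in> {0..T}. \<not> (norm (A t) \<le> a \<and> norm (B t) \<le> b)}"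
  have N: "negligible N"
    unfolding N_def using AE_conjI[OF A B] by (subst (asm) AE_lebesgue_on_negligible) auto
  \<comment> \<open>Zeroing on N turns the almost-everywhere bounds on the coefficients into a bound
    at every t, as the gauge integral comparison demands.\<close>
  define g' where "g' t = (if t \<in> N then 0 else g t)" for t
  have hc: "continuous_on {0..T} (\<lambda>t. norm (h t))"
    using absolutely_continuous_fun_continuous_on[OF ac] by (intro continuous_intros)
  have wi: "(\<lambda>t. norm (w t)) integrable_on {0..T}"
    using w by (intro integrable_on_lebesgue_on) auto
  have I: "?I = integral {0..T} (\<lambda>t. norm (w t))"
    using w by (intro lebesgue_integral_eq_integral) auto
  have "norm (h s) \<le> (norm (h 0) + b * ?I) + a * integral {0..s} (\<lambda>t. norm (h t))"
    if s: "s \<in> {0..T}" for s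
  proof -
    have "(g has_integral (h s - h 0)) {0..s}"
      using s ode unfolding g_def by (intro absolutely_continuous_fun_has_integral[OF ac]) auto
    then have g': "(g' has_integral (h s - h 0)) {0..s}"
      by (rule has_integral_spike[OF N, rotated]) (simp add: g'_def)
    have hi: "(\<lambda>t. norm (h t)) integrable_on {0..s}"
      using s by (intro integrable_continuous_real continuous_on_subset[OF hc]) auto
    have wis: "(\<lambda>t. norm (w t)) integrable_on {0..s}"
      using s by (intro integrable_on_subinterval[OF wi]) auto
    have "norm (integral {0..s} g') \<le> integral {0..s} (\<lambda>t. a * norm (h t) + b * norm (w t))"
    proof (rule Henstock_Kurzweil_Integration.integral_norm_bound_integral)
      show "g' integrable_on {0..s}" using g' by (rule has_integral_integrable)
      show "(\<lambda>t. a * norm (h t) + b * norm (w t)) integrable_on {0..s}"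
        using hi wis by (intro integrable_add integrable_on_mult_right)
      fix t assume t: "t \<in> {0..s}"
      show "norm (g' t) \<le> a * norm (h t) + b * norm (w t)"
      proof (cases "t \<in> N")
        case False
        then have "norm (A t) \<le> a" "norm (B t) \<le> b" using t s by (auto simp: N_def)
        then have "norm (A t *v h t) \<le> a * norm (h t)" "norm (B t *v w t) \<le> b * norm (w t)"
          using norm_matrix_vector_le[of "A t" "h t"] norm_matrix_vector_le[of "B t" "w t"]
          by (meson mult_right_mono norm_ge_zero order_trans)+
        then show ?thesis
          using False by (simp add: g'_def g_def norm_triangle_mono)
      qed (use ab in \<open>simp add: g'_def\<close>)
    qed
    also have "integral {0..s} g' = h s - h 0" using g' by (rule integral_unique)
    also have "integral {0..s} (\<lambda>t. a * norm (h t) + b * norm (w t)) =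
        a * integral {0..s} (\<lambda>t. norm (h t)) + b * integral {0..s} (\<lambda>t. norm (w t))"
      using hi wis by (subst Henstock_Kurzweil_Integration.integral_add) (auto intro: integrable_on_mult_right)
    also have "\<dots> \<le> a * integral {0..s} (\<lambda>t. norm (h t)) + b * ?I"
      unfolding I using s wi wis ab by (intro add_left_mono mult_left_mono integral_subset_le) auto
    finally show ?thesis
      using norm_triangle_ineq2[of "h s" "h 0"] by linarith
  qed
  then have "norm (h t) \<le> (norm (h 0) + b * ?I) * exp (a * t)"
    by (rule gronwall_integral[OF hc ab(1)]) (use t in auto)
  also have "\<dots> \<le> (norm (h 0) + b * ?I) * exp (a * T)"
    using ab t by (intro mult_left_mono) (auto intro: mult_left_mono)
  finally show ?thesis .
qed


text \<open>Used for \<open>time_deriv\<close>, whose values are unspecified where no derivative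
  exists.\<close>

lemma Lq_space_cong_AE:
  fixes u v :: "real \<Rightarrow> 'a::euclidean_space"
  assumes T: "0 < T" and q: "1 \<le> q" and u: "u \<in> Lq_space T q"
    and eq: "AE t in lebesgue_on {0..T}. u t = v t"
  shows "v \<in> Lq_space T q"
proof (rule Lq_mono(1)[OF T q _ u])
  show "v \<in> borel_measurable (lebesgue_on {0..T})"
    by (rule borel_measurable_lebesgue_on_AE_cong[OF Lq_space_measurable[OF u] _ eq]) simp
  show "AE t in lebesgue_on {0..T}. norm (v t) \<le> norm (u t)"
    using eq by eventually_elim simp
qed

lemma time_deriv_eqI:
  assumes "0 < T" "t \<in> {0..T}" "(x has_vector_derivative D) (at t within {0..T})"
  shows "time_deriv T x t = D"
  unfolding time_deriv_def by (rule vector_derivative_within_closed_interval[OF assms])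

lemma AE_time_deriv:
  assumes "0 < T" "AE t in lebesgue_on {0..T}. (x has_vector_derivative g t) (at t within {0..T})"
  shows "AE t in lebesgue_on {0..T}. time_deriv T x t = g t"
  using assms(2) by (rule AE_mp) (auto intro!: AE_I2 time_deriv_eqI[OF assms(1)])

subsection \<open>Linear control systems\<close>

locale linear_control_system =
  fixes p q :: ennreal and T :: real and x0 :: "real ^ 'd::finite"
    and U :: "(real \<Rightarrow> real ^ 'm::finite) set"
    and A :: "real \<Rightarrow> real ^ 'd ^ 'd" and B :: "real \<Rightarrow> real ^ 'm ^ 'd"
  assumes p: "1 \<le> p" and pq: "p \<le> q" and T: "0 < T"
    and U_Lq: "U \<subseteq> Lq_space T q" and U_convex: "convex_fun_set U" and U_bounded: "bounded_Lq T q U"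
    and A: "A \<in> Lq_space T \<infinity>" and B: "B \<in> Lq_space T \<infinity>"
begin

abbreviation "K \<equiv> admissible_set T p q A B U x0"

text \<open>Since a trajectory is determined by its control, the distance of the controls alone is
  equivalent to the distance of \<open>X\<close> on the admissible set.\<close>

definition control_dist :: "('d, 'm) trajectory \<Rightarrow> ('d, 'm) trajectory \<Rightarrow> real" where
  "control_dist y z = Lq_norm T q (\<lambda>t. snd y t - snd z t)"

lemma q: "1 \<le> q" using p pq by (rule order_trans)

lemma admissibleD:
  assumes "z \<in> K"
  shows "absolutely_continuous_fun T (fst z)" "time_deriv T (fst z) \<in> Lq_space T p"
    "snd z \<in> Lq_space T q" "snd z \<in> U" "fst z 0 = x0"
    "AE t in lebesgue_on {0..T}.
       (fst z has_vector_derivative (A t *v fst z t + B t *v snd z t)) (at t within {0..T})"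
  using assms by (auto simp: admissible_set_def X_space_def W1p_space_def)

lemma admissibleI:
  assumes "absolutely_continuous_fun T x" "time_deriv T x \<in> Lq_space T p" "u \<in> U" "x 0 = x0"
    "AE t in lebesgue_on {0..T}.
       (x has_vector_derivative (A t *v x t + B t *v u t)) (at t within {0..T})"
  shows "(x, u) \<in> K"
  using assms U_Lq by (auto simp: admissible_set_def X_space_def W1p_space_def)

lemma control_bound: "\<exists>C\<ge>0. \<forall>u\<in>U. Lq_norm T q u \<le> C"
  using U_bounded unfolding bounded_Lq_def
  by (meson linear max.cobounded1 max.coboundedI2 max.cobounded2)

section \<open>The pseudodistance of the controls\<close>

lemma control_dist_nonneg: "0 \<le> control_dist y z"
  unfolding control_dist_def by (rule Lq_norm_nonneg[OF T])

lemma control_dist_sym: "control_dist y z = control_dist z y"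
  unfolding control_dist_def by (rule Lq_norm_minus_commute)

lemma control_dist_refl: "control_dist z z = 0"
proof -
  have "Lq_norm T q (\<lambda>t. 0 :: real ^ 'm) \<le> 0"
  proof (cases "q = \<infinity>")
    case True
    show ?thesis unfolding True by (rule Linf_I(2)[OF T]) auto
  qed (simp add: Lq_finite(2))
  then show ?thesis
    using control_dist_nonneg[of z z] by (simp add: control_dist_def)
qed

lemma control_dist_triangle:
  assumes "x \<in> K" "y \<in> K" "z \<in> K"
  shows "control_dist x z \<le> control_dist x y + control_dist y z"
  using Lq_add(2)[OF T q Lq_diff(1)[OF T q, of "snd x" "snd y"] Lq_diff(1)[OF T q, of "snd y" "snd z"]]
    assms[THEN admissibleD(3)] by (simp add: control_dist_def)

text \<open>This D becomes the numerator of the constant in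
  \<open>endpoint_error_bound\<close>.\<close>

lemma control_dist_bounded: "\<exists>D>0. \<forall>y\<in>K. \<forall>z\<in>K. control_dist y z \<le> D"
proof -
  obtain C where C: "C \<ge> 0" "\<And>u. u \<in> U \<Longrightarrow> Lq_norm T q u \<le> C" using control_bound by blast
  have "control_dist y z \<le> 2 * C + 1" if "y \<in> K" "z \<in> K" for y z
    using Lq_diff(2)[OF T q admissibleD(3)[OF that(1)] admissibleD(3)[OF that(2)]]
      C(2)[OF admissibleD(4)[OF that(1)]] C(2)[OF admissibleD(4)[OF that(2)]]
    by (simp add: control_dist_def)
  then show ?thesis using C(1) by (intro exI[of _ "2 * C + 1"]) auto
qed

lemma control_dist_le_X_dist: "control_dist y z \<le> X_dist T p q y z"
  using Lq_norm_nonneg[OF T, of p "\<lambda>t. fst y t - fst z t"]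
    Lq_norm_nonneg[OF T, of p "time_deriv T (\<lambda>t. fst y t - fst z t)"]
  by (simp add: X_dist_def W1p_norm_def control_dist_def)

section \<open>Dependence of the state on the control\<close>

lemma AE_coefficients:
  "AE t in lebesgue_on {0..T}. norm (A t) \<le> Lq_norm T \<infinity> A"
  "AE t in lebesgue_on {0..T}. norm (B t) \<le> Lq_norm T \<infinity> B"
  using Linf_AE[OF T A] Linf_AE[OF T B] by auto

lemma AE_deriv_diff:
  assumes "y \<in> K" "z \<in> K"
  shows "AE t in lebesgue_on {0..T}. ((\<lambda>t. fst y t - fst z t) has_vector_derivative
     (A t *v (fst y t - fst z t) + B t *v (snd y t - snd z t))) (at t within {0..T})"
  using admissibleD(6)[OF assms(1)] admissibleD(6)[OF assms(2)]
proof eventually_elim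
  case (elim t)
  show ?case
    using has_vector_derivative_diff[OF elim]
    by (simp add: matrix_vector_mult_diff_distrib algebra_simps)
qed

text \<open>Lipschitz constant of the map from controls to states in the supremum norm: T + 1 comes
  from the embedding into L1, the exponential from Gronwall.\<close>

definition \<kappa> :: real where
  "\<kappa> = Lq_norm T \<infinity> B * (T + 1) * exp (Lq_norm T \<infinity> A * T)"

lemma \<kappa>_nonneg: "0 \<le> \<kappa>"
  using Lq_norm_nonneg[OF T, of \<infinity> B] T by (simp add: \<kappa>_def)

text \<open>The difference of two admissible states solves the same linear equation with initial
  value 0 and the difference of the controls as input.\<close>

lemma state_diff_le:
  assumes "y \<in> K" "z \<in> K" "t \<in> {0..T}"
  shows "norm (fst y t - fst z t) \<le> \<kappa> * control_dist y z"
proof -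
  let ?a = "Lq_norm T \<infinity> A" and ?b = "Lq_norm T \<infinity> B"
  note nn = Lq_norm_nonneg[OF T, of \<infinity> A] Lq_norm_nonneg[OF T, of \<infinity> B]
  have w: "(\<lambda>t. snd y t - snd z t) \<in> Lq_space T q"
    using assms by (intro Lq_diff[OF T q] admissibleD(3))
  have "norm (fst y t - fst z t) \<le> (norm (fst y 0 - fst z 0)
      + ?b * (\<integral>t. norm (snd y t - snd z t) \<partial>lebesgue_on {0..T})) * exp (?a * T)"
    by (rule linear_ode_bound[OF absolutely_continuous_fun_diff AE_deriv_diff AE_coefficients
          Lq_integrable(1)[OF T q w] nn assms(3)])
       (use assms admissibleD(1) in auto)
  also have "\<dots> \<le> (0 + ?b * ((T + 1) * control_dist y z)) * exp (?a * T)"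
    using Lq_integrable(2)[OF T q w] nn admissibleD(5)[OF assms(1)] admissibleD(5)[OF assms(2)]
    by (intro mult_right_mono add_mono mult_left_mono) (auto simp: control_dist_def)
  finally show ?thesis by (simp add: \<kappa>_def mult_ac)
qed

text \<open>Supplies the one radius R for which the growth conditions or the compactness bounds on
  the integrand are invoked.\<close>

lemma state_bounded: "\<exists>R>0. \<forall>z\<in>K. \<forall>t\<in>{0..T}. norm (fst z t) \<le> R"
proof -
  let ?a = "Lq_norm T \<infinity> A" and ?b = "Lq_norm T \<infinity> B"
  note nn = Lq_norm_nonneg[OF T, of \<infinity> A] Lq_norm_nonneg[OF T, of \<infinity> B]
  obtain C where C: "C \<ge> 0" "\<And>u. u \<in> U \<Longrightarrow> Lq_norm T q u \<le> C" using control_bound by blast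
  define R where "R = (norm x0 + ?b * ((T + 1) * C)) * exp (?a * T)"
  have R: "R \<ge> 0" using C(1) nn T by (simp add: R_def)
  have "norm (fst z t) \<le> R" if z: "z \<in> K" and t: "t \<in> {0..T}" for z t
  proof -
    note D = admissibleD[OF z]
    have "norm (fst z t) \<le> (norm (fst z 0) + ?b * (\<integral>t. norm (snd z t) \<partial>lebesgue_on {0..T})) * exp (?a * T)"
      by (rule linear_ode_bound[OF D(1,6) AE_coefficients Lq_integrable(1)[OF T q D(3)] nn t])
    also have "\<dots> \<le> (norm x0 + ?b * ((T + 1) * C)) * exp (?a * T)"
    proof -
      have "(\<integral>t. norm (snd z t) \<partial>lebesgue_on {0..T}) \<le> (T + 1) * Lq_norm T q (snd z)"
        by (rule Lq_integrable(2)[OF T q D(3)])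
      also have "\<dots> \<le> (T + 1) * C" using C(2)[OF D(4)] T by (intro mult_left_mono) auto
      finally show ?thesis
        using nn D(5) by (intro mult_right_mono add_mono mult_left_mono) auto
    qed
    finally show ?thesis by (simp add: R_def)
  qed
  then have "\<forall>z\<in>K. \<forall>t\<in>{0..T}. norm (fst z t) \<le> R + 1" by fastforce
  then show ?thesis using R by (intro exI[of _ "R + 1"]) auto
qed

lemma X_dist_le_control_dist:
  "\<exists>k>0. \<forall>y\<in>K. \<forall>z\<in>K. X_dist T p q y z \<le> k * control_dist y z"
proof -
  let ?a = "Lq_norm T \<infinity> A" and ?b = "Lq_norm T \<infinity> B"
  note nn = Lq_norm_nonneg[OF T, of \<infinity> A] Lq_norm_nonneg[OF T, of \<infinity> B]
  \<comment> \<open>In order: the state difference, its derivative estimated through the equation,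
    and the control difference itself.\<close>
  define k where "k = (T + 1) * \<kappa> + ((T + 1) * (?a * \<kappa>) + ?b * (T + 1)) + 1"
  have k: "k > 0" using \<kappa>_nonneg nn T by (simp add: k_def add_nonneg_pos)
  have const: "(\<lambda>t. c) \<in> Lq_space T p \<and> Lq_norm T p (\<lambda>t. c) \<le> (T + 1) * c" if "0 \<le> c" for c :: real
  proof -
    have c: "(\<lambda>t. c) \<in> Lq_space T \<infinity>" "Lq_norm T \<infinity> (\<lambda>t. c) \<le> c"
      using Linf_I[OF T, of "\<lambda>t. c" c] that by auto
    have "Lq_norm T p (\<lambda>t. c) \<le> (T + 1) * Lq_norm T \<infinity> (\<lambda>t. c)"
      by (rule Lq_embedding(2)[OF T p _ c(1)]) simp
    also have "\<dots> \<le> (T + 1) * c" using c(2) T by (intro mult_left_mono) auto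
    finally show ?thesis using Lq_embedding(1)[OF T p _ c(1)] by simp
  qed
  have "X_dist T p q y z \<le> k * control_dist y z" if y: "y \<in> K" and z: "z \<in> K" for y z
  proof -
    define N where "N = control_dist y z"
    define h where "h t = fst y t - fst z t" for t
    define w where "w t = snd y t - snd z t" for t
    have N: "N \<ge> 0" by (simp add: N_def control_dist_nonneg)
    have hN: "norm (h t) \<le> \<kappa> * N" if "t \<in> {0..T}" for t
      using state_diff_le[OF y z that] by (simp add: h_def N_def)
    have c: "0 \<le> \<kappa> * N" using N \<kappa>_nonneg by simp
    have w: "w \<in> Lq_space T q"
      unfolding w_def using y z by (intro Lq_diff[OF T q] admissibleD(3))
    have ode: "AE t in lebesgue_on {0..T}.
        (h has_vector_derivative (A t *v h t + B t *v w t)) (at t within {0..T})"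
      using AE_deriv_diff[OF y z] by (simp add: h_def[abs_def] w_def)
    have ach: "absolutely_continuous_fun T h"
      unfolding h_def using y z by (intro absolutely_continuous_fun_diff admissibleD(1))
    have "Lq_norm T p h \<le> Lq_norm T p (\<lambda>t. \<kappa> * N)"
    proof (rule Lq_mono(2)[OF T p])
      show "h \<in> borel_measurable (lebesgue_on {0..T})"
        using absolutely_continuous_fun_continuous_on[OF ach]
        by (intro continuous_imp_measurable_on_sets_lebesgue) auto
      show "AE t in lebesgue_on {0..T}. norm (h t) \<le> norm (\<kappa> * N)"
        using hN c by (intro AE_I2) auto
    qed (use const[OF c] in auto)
    then have n1: "Lq_norm T p h \<le> (T + 1) * (\<kappa> * N)" using const[OF c] by linarith
    have td: "AE t in lebesgue_on {0..T}. time_deriv T h t = A t *v h t + B t *v w t"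
      by (rule AE_time_deriv[OF T ode])
    \<comment> \<open>\<open>time_deriv\<close> is known to be additive only almost everywhere, so
      membership in the space is transferred along this equality.\<close>
    have "AE t in lebesgue_on {0..T}. time_deriv T (fst y) t - time_deriv T (fst z) t = time_deriv T h t"
      using AE_time_deriv[OF T admissibleD(6)[OF y]] AE_time_deriv[OF T admissibleD(6)[OF z]] td
      by eventually_elim (simp add: h_def w_def matrix_vector_mult_diff_distrib)
    then have tdL: "time_deriv T h \<in> Lq_space T p"
      by (rule Lq_space_cong_AE[OF T p Lq_diff(1)[OF T p admissibleD(2)[OF y] admissibleD(2)[OF z]]])
    have wp: "w \<in> Lq_space T p" "Lq_norm T p w \<le> (T + 1) * N"
      using Lq_embedding[OF T p pq w] by (auto simp: N_def control_dist_def w_def[abs_def])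
    have nwp: "(\<lambda>t. norm (w t)) \<in> Lq_space T p" "Lq_norm T p (\<lambda>t. norm (w t)) \<le> (T + 1) * N"
      using Lq_mono[OF T p _ wp(1), of "\<lambda>t. norm (w t)"] Lq_space_measurable[OF wp(1)] wp(2) by auto
    have c2: "0 \<le> ?a * (\<kappa> * N)" using nn c by simp
    let ?G = "\<lambda>t. ?a * (\<kappa> * N) + ?b *\<^sub>R norm (w t)"
    have G: "?G \<in> Lq_space T p"
      using const[OF c2] by (intro Lq_add(1)[OF T p] Lq_scaleR(1)[OF T p] nwp(1)) auto
    have "Lq_norm T p (time_deriv T h) \<le> Lq_norm T p ?G"
    proof (rule Lq_mono(2)[OF T p Lq_space_measurable[OF tdL] G])
      have "AE t in lebesgue_on {0..T}. norm (h t) \<le> \<kappa> * N"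
        using hN by (intro AE_I2) auto
      then show "AE t in lebesgue_on {0..T}. norm (time_deriv T h t) \<le> norm (?G t)"
        using td AE_coefficients
      proof eventually_elim
        case (elim t)
        have "norm (A t *v h t) \<le> ?a * (\<kappa> * N)"
          by (rule order_trans[OF norm_matrix_vector_le mult_mono]) (use elim nn in auto)
        moreover have "norm (B t *v w t) \<le> ?b * norm (w t)"
          by (rule order_trans[OF norm_matrix_vector_le mult_right_mono]) (use elim in auto)
        ultimately have "norm (A t *v h t + B t *v w t) \<le> ?G t"
          using norm_triangle_mono by fastforce
        then show ?case using elim(2) by simp
      qed
    qed
    also have "\<dots> \<le> Lq_norm T p (\<lambda>t. ?a * (\<kappa> * N)) + Lq_norm T p (\<lambda>t. ?b *\<^sub>R norm (w t))"
      using const[OF c2] by (intro Lq_add(2)[OF T p] Lq_scaleR(1)[OF T p] nwp(1)) auto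
    also have "\<dots> \<le> (T + 1) * (?a * (\<kappa> * N)) + ?b * ((T + 1) * N)"
    proof (rule add_mono)
      show "Lq_norm T p (\<lambda>t. ?a * (\<kappa> * N)) \<le> (T + 1) * (?a * (\<kappa> * N))"
        using const[OF c2] by simp
      have "Lq_norm T p (\<lambda>t. ?b *\<^sub>R norm (w t)) \<le> \<bar>?b\<bar> * Lq_norm T p (\<lambda>t. norm (w t))"
        by (rule Lq_scaleR(2)[OF T p nwp(1)])
      also have "\<dots> \<le> ?b * ((T + 1) * N)" using nn nwp(2) by (simp add: mult_left_mono)
      finally show "Lq_norm T p (\<lambda>t. ?b *\<^sub>R norm (w t)) \<le> ?b * ((T + 1) * N)" .
    qed
    finally have n2: "Lq_norm T p (time_deriv T h) \<le>
        (T + 1) * (?a * (\<kappa> * N)) + ?b * ((T + 1) * N)" .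
    have "X_dist T p q y z = Lq_norm T p h + Lq_norm T p (time_deriv T h) + N"
      by (simp add: X_dist_def W1p_norm_def h_def[abs_def] N_def control_dist_def)
    also have "\<dots> \<le> k * N"
      using n1 n2 by (simp add: k_def algebra_simps)
    finally show ?thesis by (simp add: N_def)
  qed
  then show ?thesis using k by blast
qed

lemma admissible_convex:
  assumes y: "y \<in> K" and z: "z \<in> K" and s: "0 \<le> s" "s \<le> 1"
  shows "(\<lambda>t. (1 - s) *\<^sub>R fst y t + s *\<^sub>R fst z t, \<lambda>t. (1 - s) *\<^sub>R snd y t + s *\<^sub>R snd z t) \<in> K"
proof (rule admissibleI)
  let ?x = "\<lambda>t. (1 - s) *\<^sub>R fst y t + s *\<^sub>R fst z t"
  let ?u = "\<lambda>t. (1 - s) *\<^sub>R snd y t + s *\<^sub>R snd z t"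
  show "absolutely_continuous_fun T ?x"
    using y z by (intro absolutely_continuous_fun_add absolutely_continuous_fun_scaleR admissibleD(1))
  show "?u \<in> U"
    using U_convex[unfolded convex_fun_set_def] admissibleD(4)[OF y] admissibleD(4)[OF z] s by simp
  show "?x 0 = x0"
    using admissibleD(5)[OF y] admissibleD(5)[OF z] by (simp add: scaleR_left.add[symmetric])
  show ode: "AE t in lebesgue_on {0..T}.
      (?x has_vector_derivative (A t *v ?x t + B t *v ?u t)) (at t within {0..T})"
    using admissibleD(6)[OF y] admissibleD(6)[OF z]
  proof eventually_elim
    case (elim t)
    have "(?x has_vector_derivative ((1 - s) *\<^sub>R (A t *v fst y t + B t *v snd y t)
        + s *\<^sub>R (A t *v fst z t + B t *v snd z t))) (at t within {0..T})"
      using elim by (auto intro!: derivative_eq_intros)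
    then show ?case
      by (simp add: matrix_vector_right_distrib matrix_vector_mult_scaleR scaleR_add_right add_ac)
  qed
  have "AE t in lebesgue_on {0..T}. (1 - s) *\<^sub>R time_deriv T (fst y) t + s *\<^sub>R time_deriv T (fst z) t
      = time_deriv T ?x t"
    using AE_time_deriv[OF T admissibleD(6)[OF y]] AE_time_deriv[OF T admissibleD(6)[OF z]]
      AE_time_deriv[OF T ode]
    by eventually_elim
       (simp add: matrix_vector_right_distrib matrix_vector_mult_scaleR scaleR_add_right add_ac)
  then show "time_deriv T ?x \<in> Lq_space T p"
    by (rule Lq_space_cong_AE[OF T p, rotated])
       (intro Lq_add(1)[OF T p] Lq_scaleR(1)[OF T p] admissibleD(2) y z)
qed

text \<open>A point of the relative interior can be overshot: the reachable set contains a point beyond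
  \<open>xT\<close> on the ray from the endpoint of \<open>z\<close> through \<open>xT\<close>, at a fixed distance from \<open>xT\<close>.\<close>

lemma endpoint_error_bound:
  assumes relint: "xT \<in> rel_interior (reachable_set T p q A B U x0)"
  shows "\<exists>a>0. \<forall>z\<in>K. \<forall>s. 0 < endpoint_penalty T xT z \<longrightarrow> 0 < s \<longrightarrow> s \<le> 1 \<longrightarrow>
     (\<exists>y\<in>K. endpoint_penalty T xT y = (1 - s) * endpoint_penalty T xT z \<and>
        control_dist y z \<le> s * (a * endpoint_penalty T xT z))"
proof -
  let ?\<phi> = "endpoint_penalty T xT"
  define \<R> where "\<R> = reachable_set T p q A B U x0"
  have R: "v \<in> \<R> \<longleftrightarrow> (\<exists>z\<in>K. fst z T = v)" for v
    by (force simp: \<R>_def reachable_set_def)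
  obtain D where D: "D > 0" "\<And>y z. y \<in> K \<Longrightarrow> z \<in> K \<Longrightarrow> control_dist y z \<le> D"
    using control_dist_bounded by blast
  obtain e where e: "e > 0" "cball xT e \<inter> affine hull \<R> \<subseteq> \<R>" and xTR: "xT \<in> \<R>"
    using relint unfolding \<R>_def[symmetric] mem_rel_interior_cball by blast
  have "\<exists>y\<in>K. ?\<phi> y = (1 - s) * ?\<phi> z \<and> control_dist y z \<le> s * (D / e * ?\<phi> z)"
    if z: "z \<in> K" and pos: "0 < ?\<phi> z" and s: "0 < s" "s \<le> 1" for z s
  proof -
    define f where "f = ?\<phi> z"
    have f: "f > 0" "f = norm (fst z T - xT)" using pos by (auto simp: f_def endpoint_penalty_def)
    \<comment> \<open>The scaling by e / f places v at distance exactly e from \<open>xT\<close>,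
      however close to \<open>xT\<close> the endpoint of z is.\<close>
    define v where "v = xT + (e / f) *\<^sub>R (xT - fst z T)"
    have "norm (v - xT) = e" using f e(1) by (simp add: v_def norm_minus_commute)
    then have "v \<in> cball xT e" by (simp add: dist_norm norm_minus_commute)
    moreover have "v \<in> affine hull \<R>"
    proof -
      have "v = (1 + e / f) *\<^sub>R xT + (- (e / f)) *\<^sub>R fst z T"
        by (simp add: v_def algebra_simps)
      moreover have "xT \<in> affine hull \<R>" "fst z T \<in> affine hull \<R>"
        using xTR R z by (auto intro: hull_inc)
      ultimately show ?thesis
        using mem_affine[OF affine_affine_hull, of xT \<R> "fst z T" "1 + e / f" "- (e / f)"] by simp
    qed
    ultimately obtain zh where zh: "zh \<in> K" "fst zh T = v" using e(2) R by blast
    \<comment> \<open>The segment from the endpoint of z to v has length f + e and meets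
      \<open>xT\<close> after length f; s takes a part of that way. Since \<sigma> \<le> s * (f /
      e), the step costs at most s * (D / e) * f in control distance.\<close>
    define \<sigma> where "\<sigma> = s * (f / (f + e))"
    have \<sigma>: "0 \<le> \<sigma>" "\<sigma> \<le> 1" "\<sigma> \<le> s * (f / e)"
    proof -
      show "0 \<le> \<sigma>" using s f(1) e(1) by (simp add: \<sigma>_def)
      have "f / (f + e) \<le> 1" using f(1) e(1) by simp
      then show "\<sigma> \<le> 1" unfolding \<sigma>_def using s f(1) e(1) by (intro mult_le_one) auto
      have "f / (f + e) \<le> f / e" using f(1) e(1) by (intro divide_left_mono) auto
      then show "\<sigma> \<le> s * (f / e)" unfolding \<sigma>_def using s by (intro mult_left_mono) auto
    qed
    define y where "y = (\<lambda>t. (1 - \<sigma>) *\<^sub>R fst z t + \<sigma> *\<^sub>R fst zh t,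
        \<lambda>t. (1 - \<sigma>) *\<^sub>R snd z t + \<sigma> *\<^sub>R snd zh t)"
    have y: "y \<in> K" unfolding y_def by (rule admissible_convex[OF z zh(1) \<sigma>(1,2)])
    have "1 + e / f = (f + e) / f" using f(1) by (simp add: add_divide_distrib)
    then have "\<sigma> * (1 + e / f) = s" using f(1) e(1) by (simp add: \<sigma>_def)
    then have \<sigma>s: "\<sigma> * (e / f) = s - \<sigma>" by (simp add: algebra_simps)
    have "fst y T - xT = (fst z T - xT) - \<sigma> *\<^sub>R (fst z T - xT) + \<sigma> *\<^sub>R ((e / f) *\<^sub>R (xT - fst z T))"
      by (simp add: y_def zh(2) v_def algebra_simps)
    also have "\<dots> = (1 - s) *\<^sub>R (fst z T - xT)"
      unfolding scaleR_scaleR \<sigma>s by (simp add: algebra_simps)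
    finally have "?\<phi> y = (1 - s) * ?\<phi> z"
      using s by (simp add: endpoint_penalty_def)
    moreover have "control_dist y z \<le> s * (D / e * ?\<phi> z)"
    proof -
      have "(\<lambda>t. snd y t - snd z t) = (\<lambda>t. \<sigma> *\<^sub>R (snd zh t - snd z t))"
        by (simp add: y_def algebra_simps)
      then have "control_dist y z \<le> \<bar>\<sigma>\<bar> * control_dist zh z"
        unfolding control_dist_def
        using Lq_scaleR(2)[OF T q Lq_diff(1)[OF T q admissibleD(3)[OF zh(1)] admissibleD(3)[OF z]]]
        by simp
      also have "\<dots> \<le> \<sigma> * D" using \<sigma>(1) D(2)[OF zh(1) z] by (simp add: mult_left_mono)
      also have "\<dots> \<le> s * (f / e) * D" using \<sigma>(3) D(1) by (intro mult_right_mono) auto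
      finally show ?thesis by (simp add: f_def mult_ac)
    qed
    ultimately show ?thesis using y by blast
  qed
  then show ?thesis using D(1) e(1) by (intro exI[of _ "D / e"]) auto
qed

end


subsection \<open>Lipschitz continuity of the cost\<close>

text \<open>The mean value inequality on a convex set.\<close>

lemma GDERIV_bound:
  fixes f :: "'a::euclidean_space \<Rightarrow> real"
  assumes deriv: "\<And>y. GDERIV f y :> D y" and S: "convex S" "x \<in> S" "x' \<in> S"
    and bound: "\<And>y. y \<in> S \<Longrightarrow> norm (D y) \<le> M"
  shows "\<bar>f x - f x'\<bar> \<le> M * norm (x - x')"
proof -
  have "norm (f x - f x') \<le> M * norm (x - x')"
  proof (rule differentiable_bound[OF S(1) _ _ S(2,3)])
    fix y assume y: "y \<in> S"
    show "(f has_derivative (\<lambda>h. inner h (D y))) (at y within S)"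
      using deriv[of y] unfolding gderiv_def by (rule has_derivative_at_withinI)
    show "onorm (\<lambda>h. inner h (D y)) \<le> M"
    proof (rule onorm_le)
      fix h
      have "norm (inner h (D y)) \<le> norm h * norm (D y)" by (simp add: Cauchy_Schwarz_ineq2)
      also have "\<dots> \<le> M * norm h" using mult_left_mono[OF bound[OF y] norm_ge_zero[of h]] by (simp add: mult.commute)
      finally show "norm (inner h (D y)) \<le> M * norm h" .
    qed
  qed
  then show ?thesis by simp
qed

text \<open>Continuity is given only for times in [0,T]. Clamping the time by \<open>max\<close> and
  \<open>min\<close> gives a function continuous on the whole space, hence Borel, which may be
  composed with Lebesgue measurable maps.\<close>

lemma measurable_superposition:
  fixes x :: "real \<Rightarrow> 'a::euclidean_space" and u :: "real \<Rightarrow> 'b::euclidean_space"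
    and \<theta> :: "'a \<Rightarrow> 'b \<Rightarrow> real \<Rightarrow> real"
  assumes T: "0 < T" and cont: "continuous_on (UNIV \<times> UNIV \<times> {0..T}) (\<lambda>(x, u, t). \<theta> x u t)"
    and x: "x \<in> borel_measurable (lebesgue_on {0..T})"
    and u: "u \<in> borel_measurable (lebesgue_on {0..T})"
  shows "(\<lambda>t. \<theta> (x t) (u t) t) \<in> borel_measurable (lebesgue_on {0..T})"
proof -
  define F where "F = (\<lambda>z. \<theta> (fst z) (fst (snd z)) (max 0 (min T (snd (snd z)))))"
  have "continuous_on UNIV ((\<lambda>(x, u, t). \<theta> x u t) \<circ>
      (\<lambda>z. (fst z, fst (snd z), max 0 (min T (snd (snd z))))))"
    using T by (intro continuous_on_compose continuous_on_subset[OF cont] continuous_intros) auto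
  then have "continuous_on UNIV F" by (simp add: F_def o_def)
  then have F: "F \<in> borel_measurable borel" by (rule borel_measurable_continuous_onI)
  have id: "(\<lambda>t. t) \<in> borel_measurable (lebesgue_on {0..T})"
    by (rule continuous_imp_measurable_on_sets_lebesgue) (auto intro: continuous_intros)
  have "(\<lambda>t. (x t, u t, t)) \<in> borel_measurable (lebesgue_on {0..T})"
    by (intro borel_measurable_Pair x u id)
  then have "(\<lambda>t. F (x t, u t, t)) \<in> borel_measurable (lebesgue_on {0..T})"
    using F by (rule measurable_compose)
  then show ?thesis
    by (rule measurable_cong[THEN iffD1, rotated]) (auto simp: F_def)
qed

text \<open>A crude form of Young's inequality, sufficient in place of Hoelder's below.\<close>

lemma product_le_powr_sum:
  fixes a b r :: real
  assumes r: "1 < r" and ab: "0 \<le> a" "0 \<le> b"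
  shows "a * b \<le> a powr (r / (r - 1)) + b powr r"
\<comment> \<open>The two powers balance at a = b powr (r - 1); on either side one factor is
  replaced by a power of the other.\<close>
proof (cases "a \<le> b powr (r - 1)")
  case True
  have "a * b \<le> b powr (r - 1) * b" using True ab by (intro mult_right_mono)
  also have "\<dots> = b powr r"
    using ab powr_mult_base[of b "r - 1"] by (simp add: mult.commute)
  finally show ?thesis by (simp add: add_increasing)
next
  case False
  have "b = (b powr (r - 1)) powr (1 / (r - 1))" using ab r by (simp add: powr_powr)
  also have "\<dots> \<le> a powr (1 / (r - 1))" using False r ab by (intro powr_mono2) auto
  finally have "a * b \<le> a * a powr (1 / (r - 1))" using ab by (intro mult_left_mono)
  also have "\<dots> = a powr (1 + 1 / (r - 1))"
    using ab by (simp add: powr_mult_base)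
  also have "1 + 1 / (r - 1) = r / (r - 1)" using r by (simp add: field_simps)
  finally show ?thesis by (simp add: add_increasing2)
qed

text \<open>Young's inequality for g and w / N, multiplied by N. The result is homogeneous in w
  only, which is enough because g will range over weights whose conjugate powers have uniformly
  bounded integrals.\<close>

lemma conjugate_product_bound:
  fixes g :: "real \<Rightarrow> real" and w :: "real \<Rightarrow> 'a::euclidean_space"
  assumes T: "0 < T" and q: "1 < q" "q \<noteq> \<infinity>"
    and g: "g \<in> borel_measurable (lebesgue_on {0..T})" "\<And>t. 0 \<le> g t"
    and gi: "integrable (lebesgue_on {0..T}) (\<lambda>t. g t powr (enn2real q / (enn2real q - 1)))"
    and w: "w \<in> Lq_space T q"
  shows "integrable (lebesgue_on {0..T}) (\<lambda>t. g t * norm (w t))"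
    "(\<integral>t. g t * norm (w t) \<partial>lebesgue_on {0..T}) \<le>
      (1 + (\<integral>t. g t powr (enn2real q / (enn2real q - 1)) \<partial>lebesgue_on {0..T})) * Lq_norm T q w"
proof -
  let ?r = "enn2real q" and ?M = "lebesgue_on {0..T}"
  let ?s = "?r / (?r - 1)"
  let ?G = "\<integral>t. g t powr ?s \<partial>?M"
  have q1: "1 \<le> q" using q by simp
  have r: "1 < ?r"
  proof -
    have "?r \<noteq> 1" using q by (metis ennreal_1 ennreal_enn2real infinity_ennreal_def less_top less_irrefl top.not_eq_extremum)
    then show ?thesis using enn2real_ge_1[OF q1 q(2)] by linarith
  qed
  note nn = Lq_norm_nonneg[OF T, of q w]
  have G: "0 \<le> ?G" by (intro integral_nonneg_AE) auto
  note [measurable] = g(1) Lq_space_measurable[OF w]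
  have bound: "integrable ?M (\<lambda>t. g t * norm (w t)) \<and>
      (\<integral>t. g t * norm (w t) \<partial>?M) \<le> (1 + ?G) * N"
    if N: "Lq_norm T q w \<le> N" "0 < N" for N
  proof -
    note wi = Lq_scaled_integrable[OF q1 q(2) N(2) w]
    let ?h = "\<lambda>t. N * (g t powr ?s + (norm (w t) / N) powr ?r)"
    have le: "g t * norm (w t) \<le> ?h t" for t
    proof -
      have "N * (g t * (norm (w t) / N)) \<le> ?h t"
        using product_le_powr_sum[OF r, of "g t" "norm (w t) / N"] g(2)[of t] N by (intro mult_left_mono) auto
      then show ?thesis using N by simp
    qed
    have hi: "integrable ?M ?h" using gi wi by auto
    have i: "integrable ?M (\<lambda>t. g t * norm (w t))"
      by (rule Bochner_Integration.integrable_bound[OF hi], measurable)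
         (use le g(2) N(2) in \<open>auto simp: abs_mult intro!: AE_I2 intro: order_trans[OF _ abs_ge_self]\<close>)
    have "(\<integral>t. g t * norm (w t) \<partial>?M) \<le> (\<integral>t. ?h t \<partial>?M)"
      by (rule integral_mono[OF i hi le])
    also have "\<dots> = N * (?G + (\<integral>t. (norm (w t) / N) powr ?r \<partial>?M))"
      using gi wi by simp
    also have "\<dots> \<le> N * (?G + 1)"
      using Lq_norm_le_iff[OF q1 q(2) N(2), of T w] N by (intro mult_left_mono) auto
    finally show ?thesis using i by (simp add: algebra_simps)
  qed
  show "integrable ?M (\<lambda>t. g t * norm (w t))"
    using bound[of "Lq_norm T q w + 1"] nn by simp
  show "(\<integral>t. g t * norm (w t) \<partial>?M) \<le> (1 + ?G) * Lq_norm T q w"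
  proof (rule field_le_epsilon)
    fix e :: real assume "0 < e"
    then show "(\<integral>t. g t * norm (w t) \<partial>?M) \<le> (1 + ?G) * Lq_norm T q w + e"
      using bound[of "Lq_norm T q w + e / (1 + ?G)"] nn G
      by (simp add: distrib_left add_nonneg_pos)
  qed
qed

context linear_control_system
begin

lemma admissible_measurable:
  assumes "z \<in> K"
  shows "fst z \<in> borel_measurable (lebesgue_on {0..T})" "snd z \<in> borel_measurable (lebesgue_on {0..T})"
  using absolutely_continuous_fun_continuous_on[OF admissibleD(1)[OF assms]]
    Lq_space_measurable[OF admissibleD(3)[OF assms]]
  by (auto intro: continuous_imp_measurable_on_sets_lebesgue)

text \<open>State differences are bounded uniformly in t through \<kappa>, so an integrable weight
  \<alpha> is enough for them. Control differences are small only in Lq, so their weight \<beta>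
  stays paired with them under the integral. This is the asymmetry between the growth orders of the
  two gradients.\<close>

lemma cost_lipschitz_if_integrand_bound:
  assumes y: "y \<in> K" and z: "z \<in> K"
    and int: "\<And>z. z \<in> K \<Longrightarrow> integrable (lebesgue_on {0..T}) (\<lambda>t. \<theta> (fst z t) (snd z t) t)"
    and \<alpha>: "integrable (lebesgue_on {0..T}) \<alpha>" "(\<integral>t. \<alpha> t \<partial>lebesgue_on {0..T}) \<le> Ca"
      "AE t in lebesgue_on {0..T}. 0 \<le> \<alpha> t"
    and \<beta>: "integrable (lebesgue_on {0..T}) (\<lambda>t. \<beta> t * norm (snd y t - snd z t))"
      "(\<integral>t. \<beta> t * norm (snd y t - snd z t) \<partial>lebesgue_on {0..T}) \<le> Cb * control_dist y z"
    and le: "AE t in lebesgue_on {0..T}. \<bar>\<theta> (fst y t) (snd y t) t - \<theta> (fst z t) (snd z t) t\<bar>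
       \<le> \<alpha> t * norm (fst y t - fst z t) + \<beta> t * norm (snd y t - snd z t)"
  shows "\<bar>cost T \<theta> y - cost T \<theta> z\<bar> \<le> (Ca * \<kappa> + Cb) * control_dist y z"
proof -
  let ?M = "lebesgue_on {0..T}" and ?N = "control_dist y z"
  let ?d = "\<lambda>t. \<theta> (fst y t) (snd y t) t - \<theta> (fst z t) (snd z t) t"
  have di: "integrable ?M ?d" using int[OF y] int[OF z] by (rule Bochner_Integration.integrable_diff)
  have "\<bar>cost T \<theta> y - cost T \<theta> z\<bar> = \<bar>\<integral>t. ?d t \<partial>?M\<bar>"
    using int[OF y] int[OF z] by (simp add: cost_def)
  also have "\<dots> \<le> (\<integral>t. \<bar>?d t\<bar> \<partial>?M)" by (rule integral_abs_bound)
  also have "\<dots> \<le> (\<integral>t. \<alpha> t * (\<kappa> * ?N) + \<beta> t * norm (snd y t - snd z t) \<partial>?M)"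
  proof (rule integral_mono_AE)
    show "integrable ?M (\<lambda>t. \<bar>?d t\<bar>)" using di by (rule integrable_abs)
    show "integrable ?M (\<lambda>t. \<alpha> t * (\<kappa> * ?N) + \<beta> t * norm (snd y t - snd z t))"
      using \<alpha>(1) \<beta>(1) by (intro Bochner_Integration.integrable_add integrable_mult_left) auto
    have "AE t in ?M. norm (fst y t - fst z t) \<le> \<kappa> * ?N"
      using state_diff_le[OF y z] by (intro AE_I2) auto
    then show "AE t in ?M. \<bar>?d t\<bar> \<le> \<alpha> t * (\<kappa> * ?N) + \<beta> t * norm (snd y t - snd z t)"
      using le \<alpha>(3)
    proof eventually_elim
      case (elim t)
      show ?case using elim(2) mult_left_mono[OF elim(1,3)] by linarith
    qed
  qed
  also have "\<dots> = (\<integral>t. \<alpha> t \<partial>?M) * (\<kappa> * ?N) + (\<integral>t. \<beta> t * norm (snd y t - snd z t) \<partial>?M)"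
    using \<alpha>(1) \<beta>(1) by (subst Bochner_Integration.integral_add) auto
  also have "\<dots> \<le> Ca * (\<kappa> * ?N) + Cb * ?N"
    using \<alpha>(2) \<beta>(2) \<kappa>_nonneg control_dist_nonneg[of y z] by (intro add_mono mult_right_mono) auto
  finally show ?thesis by (simp add: algebra_simps)
qed

end

lemma growth_conditionE:
  assumes "growth_condition T l s g" "0 < R"
  obtains C \<omega> where "0 < C" "\<omega> \<in> Lq_space T s"
    "AE t in lebesgue_on {0..T}. (0::real) \<le> \<omega> t"
    "AE t in lebesgue_on {0..T}. \<forall>x u. norm x \<le> R \<longrightarrow>
       norm (g x u t) \<le> C * (if l = 0 then 1 else norm u powr l) + \<omega> t"
  using assms unfolding growth_condition_def by blast

text \<open>The state is changed first, at the fixed control u, and then the control, at the fixed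
  state x'. The segments stay in balls, where the gradients are bounded by norms of the
  endpoints.\<close>

lemma integrand_diff_le:
  fixes \<theta> :: "'a::euclidean_space \<Rightarrow> 'b::euclidean_space \<Rightarrow> real \<Rightarrow> real"
  assumes grad_x: "\<And>x u. GDERIV (\<lambda>y. \<theta> y u t) x :> \<theta>x x u t"
    and grad_u: "\<And>x u. GDERIV (\<lambda>v. \<theta> x v t) u :> \<theta>u x u t"
    and x: "norm x \<le> R" "norm x' \<le> R"
    and a: "\<And>y. norm y \<le> R \<Longrightarrow> norm (\<theta>x y u t) \<le> a"
    and b: "\<And>v. norm v \<le> max (norm u) (norm u') \<Longrightarrow> norm (\<theta>u x' v t) \<le> b"
  shows "\<bar>\<theta> x u t - \<theta> x' u' t\<bar> \<le> a * norm (x - x') + b * norm (u - u')"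
proof -
  have "\<bar>\<theta> x u t - \<theta> x' u t\<bar> \<le> a * norm (x - x')"
    by (rule GDERIV_bound[where S = "cball 0 R", OF grad_x]) (use x a in auto)
  moreover have "\<bar>\<theta> x' u t - \<theta> x' u' t\<bar> \<le> b * norm (u - u')"
    by (rule GDERIV_bound[where S = "cball 0 (max (norm u) (norm u'))", OF grad_u]) (use b in auto)
  ultimately show ?thesis by linarith
qed

locale control_problem = linear_control_system p q T x0 U A B
  for p q :: ennreal and T :: real and x0 :: "real ^ 'd::finite"
    and U :: "(real \<Rightarrow> real ^ 'm::finite) set"
    and A :: "real \<Rightarrow> real ^ 'd ^ 'd" and B :: "real \<Rightarrow> real ^ 'm ^ 'd" +
  fixes \<theta> :: "real ^ 'd \<Rightarrow> real ^ 'm \<Rightarrow> real \<Rightarrow> real"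
    and \<theta>x :: "real ^ 'd \<Rightarrow> real ^ 'm \<Rightarrow> real \<Rightarrow> real ^ 'd"
    and \<theta>u :: "real ^ 'd \<Rightarrow> real ^ 'm \<Rightarrow> real \<Rightarrow> real ^ 'm"
  assumes theta_cont: "continuous_on (UNIV \<times> UNIV \<times> {0..T}) (\<lambda>(x, u, t). \<theta> x u t)"
    and grad_x: "\<And>x u t. t \<in> {0..T} \<Longrightarrow> GDERIV (\<lambda>y. \<theta> y u t) x :> \<theta>x x u t"
    and grad_u: "\<And>x u t. t \<in> {0..T} \<Longrightarrow> GDERIV (\<lambda>v. \<theta> x v t) u :> \<theta>u x u t"
begin

section \<open>Lipschitz estimates for the cost, for finite and infinite q\<close>

lemma integrand_measurable:
  assumes "z \<in> K"
  shows "(\<lambda>t. \<theta> (fst z t) (snd z t) t) \<in> borel_measurable (lebesgue_on {0..T})"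
  using admissible_measurable[OF assms] by (rule measurable_superposition[OF T theta_cont])

lemma AE_interval: "AE t in lebesgue_on {0..T}. t \<in> {0..T}"
  by (intro AE_I2) simp

lemma integrand_integrable_growth:
  assumes qc: "q \<noteq> \<infinity>" and growth: "growth_condition T (enn2real q) 1 \<theta>" and z: "z \<in> K"
  shows "integrable (lebesgue_on {0..T}) (\<lambda>t. \<theta> (fst z t) (snd z t) t)"
proof -
  let ?M = "lebesgue_on {0..T}"
  have r: "enn2real q \<noteq> 0" using enn2real_ge_1[OF q qc] by simp
  obtain R where R: "R > 0" "\<And>z t. z \<in> K \<Longrightarrow> t \<in> {0..T} \<Longrightarrow> norm (fst z t) \<le> R"
    using state_bounded by blast
  obtain C \<omega> where C: "0 < C" "\<omega> \<in> Lq_space T 1" "AE t in ?M. 0 \<le> \<omega> t"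
    "AE t in ?M. \<forall>x u. norm x \<le> R \<longrightarrow> norm (\<theta> x u t) \<le> C * norm u powr enn2real q + \<omega> t"
    using growth_conditionE[OF growth R(1)] r by auto
  have i: "integrable ?M (\<lambda>t. C * norm (snd z t) powr enn2real q + \<omega> t)"
    using admissibleD(3)[OF z] qc C(2) by (auto simp: Lq_finite(1) L1_space_iff)
  show ?thesis
  proof (rule Bochner_Integration.integrable_bound[OF i integrand_measurable[OF z]])
    show "AE t in ?M. norm (\<theta> (fst z t) (snd z t) t) \<le>
        norm (C * norm (snd z t) powr enn2real q + \<omega> t)"
      using C(4) AE_interval
    proof eventually_elim
      case (elim t)
      then have "norm (\<theta> (fst z t) (snd z t) t) \<le> C * norm (snd z t) powr enn2real q + \<omega> t"
        using R(2)[OF z] by blast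
      then show ?case by simp
    qed
  qed
qed

lemma cost_lipschitz_finite:
  assumes qc: "q \<noteq> \<infinity>" and growth: "growth_condition T (enn2real q) 1 \<theta>"
    "growth_condition T (enn2real q) 1 \<theta>x"
    "growth_condition T (enn2real q - 1) (conjugate_exponent q) \<theta>u"
  shows "\<exists>L\<ge>0. \<forall>y\<in>K. \<forall>z\<in>K. \<bar>cost T \<theta> y - cost T \<theta> z\<bar> \<le> L * control_dist y z"
proof -
  let ?M = "lebesgue_on {0..T}" and ?r = "enn2real q"
  note q1 = q
  have r: "1 \<le> ?r" by (rule enn2real_ge_1[OF q1 qc])
  obtain R where R: "R > 0" "\<And>z t. z \<in> K \<Longrightarrow> t \<in> {0..T} \<Longrightarrow> norm (fst z t) \<le> R"
    using state_bounded by blast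
  obtain C where C: "C \<ge> 0" "\<And>u. u \<in> U \<Longrightarrow> Lq_norm T q u \<le> C" using control_bound by blast
  \<comment> \<open>One bound for the q-th power integrals of all admissible controls; it makes the
    Lipschitz constant uniform.\<close>
  define S where "S = C powr ?r"
  have S: "0 \<le> S" "\<And>z. z \<in> K \<Longrightarrow> (\<integral>t. norm (snd z t) powr ?r \<partial>?M) \<le> S"
  proof -
    fix z assume z: "z \<in> K"
    have "(\<integral>t. norm (snd z t) powr ?r \<partial>?M) powr (1 / ?r) \<le> C"
      using C(2)[OF admissibleD(4)[OF z]] Lq_finite(2)[OF qc] by metis
    then show "(\<integral>t. norm (snd z t) powr ?r \<partial>?M) \<le> S"
      unfolding S_def using r by (subst (asm) powr_inverse_le_iff) auto
  qed (simp add: S_def)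
  have ui: "integrable ?M (\<lambda>t. norm (snd z t) powr ?r)" if "z \<in> K" for z
    using admissibleD(3)[OF that] qc by (simp add: Lq_finite(1))
  have Lw: "(\<lambda>t. snd y t - snd z t) \<in> Lq_space T q" if "y \<in> K" "z \<in> K" for y z
    using that by (intro Lq_diff[OF T q1] admissibleD(3))
  obtain C1 \<omega>1 where C1: "0 < C1" "\<omega>1 \<in> Lq_space T 1" "AE t in ?M. 0 \<le> \<omega>1 t"
    "AE t in ?M. \<forall>x u. norm x \<le> R \<longrightarrow> norm (\<theta>x x u t) \<le> C1 * norm u powr ?r + \<omega>1 t"
    using growth_conditionE[OF growth(2) R(1)] r by auto
  \<comment> \<open>The convention of \<open>growth_condition\<close> for exponent 0, which occurs
    when q = 1.\<close>
  define pw where "pw v = (if ?r - 1 = 0 then 1 else norm v powr (?r - 1))" for v :: "real ^ 'm"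
  obtain C2 \<omega>2 where C2: "0 < C2" "\<omega>2 \<in> Lq_space T (conjugate_exponent q)" "AE t in ?M. 0 \<le> \<omega>2 t"
    "AE t in ?M. \<forall>x u. norm x \<le> R \<longrightarrow> norm (\<theta>u x u t) \<le> C2 * pw u + \<omega>2 t"
    using growth_conditionE[OF growth(3) R(1)] unfolding pw_def by auto
  have pw_max: "pw v \<le> pw u + pw u'" if "norm v \<le> max (norm u) (norm u')" for v u u'
  proof (cases "?r - 1 = 0")
    case False
    then have "norm v powr (?r - 1) \<le> max (norm u) (norm u') powr (?r - 1)"
      using that r by (intro powr_mono2) auto
    also have "\<dots> \<le> norm u powr (?r - 1) + norm u' powr (?r - 1)"
      by (auto simp: max_def)
    finally show ?thesis using False by (simp add: pw_def)
  qed (simp add: pw_def)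
  have products: "\<exists>H\<ge>0. \<forall>v\<in>K. \<forall>y\<in>K. \<forall>z\<in>K.
      integrable ?M (\<lambda>t. pw (snd v t) * norm (snd y t - snd z t)) \<and>
      (\<integral>t. pw (snd v t) * norm (snd y t - snd z t) \<partial>?M) \<le> H * control_dist y z \<and>
      integrable ?M (\<lambda>t. \<bar>\<omega>2 t\<bar> * norm (snd y t - snd z t)) \<and>
      (\<integral>t. \<bar>\<omega>2 t\<bar> * norm (snd y t - snd z t) \<partial>?M) \<le> H * control_dist y z"
  proof (cases "q = 1")
    \<comment> \<open>For q = 1 the conjugate exponent is infinite: both weights are essentially
      bounded and the L1 estimate suffices.\<close>
    case True
    define c where "c = Lq_norm T \<infinity> \<omega>2"
    have c: "c \<ge> 0" unfolding c_def by (rule Lq_norm_nonneg[OF T])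
    have om: "\<omega>2 \<in> Lq_space T \<infinity>" using C2(2) True by (simp add: conjugate_exponent_def)
    have "AE t in ?M. \<bar>\<omega>2 t\<bar> \<le> c" using Linf_AE[OF T om] by (simp add: c_def)
    note omc = this
    have pw1: "pw v = 1" for v using True by (simp add: pw_def)
    have H: "integrable ?M (\<lambda>t. norm (w t)) \<and> (\<integral>t. norm (w t) \<partial>?M) \<le> (T + 1) * Lq_norm T q w \<and>
        integrable ?M (\<lambda>t. \<bar>\<omega>2 t\<bar> * norm (w t)) \<and>
        (\<integral>t. \<bar>\<omega>2 t\<bar> * norm (w t) \<partial>?M) \<le> c * (T + 1) * Lq_norm T q w"
      if w: "w \<in> Lq_space T q" for w :: "real \<Rightarrow> real ^ 'm"
    proof -
      note [measurable] = Lq_space_measurable[OF w] Lq_space_measurable[OF om]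
      note wi = Lq_integrable[OF T q1 w]
      have ni: "integrable ?M (\<lambda>t. c * norm (w t))" using wi(1) by simp
      have le: "AE t in ?M. \<bar>\<omega>2 t\<bar> * norm (w t) \<le> c * norm (w t)"
        using omc by eventually_elim (rule mult_right_mono, auto)
      have i: "integrable ?M (\<lambda>t. \<bar>\<omega>2 t\<bar> * norm (w t))"
        by (rule Bochner_Integration.integrable_bound[OF ni], measurable)
           (use omc in \<open>eventually_elim, auto simp: abs_mult mult_right_mono\<close>)
      have "(\<integral>t. \<bar>\<omega>2 t\<bar> * norm (w t) \<partial>?M) \<le> (\<integral>t. c * norm (w t) \<partial>?M)"
        by (rule integral_mono_AE[OF i ni le])
      also have "\<dots> \<le> c * ((T + 1) * Lq_norm T q w)"
        using wi(2) c by (simp add: mult_left_mono)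
      finally show ?thesis using wi i by (simp add: mult_ac)
    qed
    define H where "H = max (T + 1) (c * (T + 1))"
    have "H \<ge> 0" using T by (simp add: H_def)
    have le: "(T + 1) * N \<le> H * N" "c * (T + 1) * N \<le> H * N" if "0 \<le> N" for N
      using that by (auto simp: H_def intro!: mult_right_mono)
    show ?thesis
    proof (intro exI[of _ H] conjI ballI \<open>H \<ge> 0\<close>)
      fix v y z assume vyz: "v \<in> K" "y \<in> K" "z \<in> K"
      note h = H[OF Lw[OF vyz(2,3)], folded control_dist_def] le[OF control_dist_nonneg[of y z]]
      show "integrable ?M (\<lambda>t. pw (snd v t) * norm (snd y t - snd z t))"
        "integrable ?M (\<lambda>t. \<bar>\<omega>2 t\<bar> * norm (snd y t - snd z t))"
        using h by (simp_all add: pw1)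
      show "(\<integral>t. pw (snd v t) * norm (snd y t - snd z t) \<partial>?M) \<le> H * control_dist y z"
        unfolding pw1 mult_1 using h by linarith
      show "(\<integral>t. \<bar>\<omega>2 t\<bar> * norm (snd y t - snd z t) \<partial>?M) \<le> H * control_dist y z"
        using h by linarith
    qed
  next
    case False
    then have q2: "1 < q" using q1 by simp
    have r1: "?r \<noteq> 1"
      using False qc by (metis ennreal_1 ennreal_enn2real infinity_ennreal_def less_top)
    let ?s = "?r / (?r - 1)"
    have ce: "conjugate_exponent q \<noteq> \<infinity>" "enn2real (conjugate_exponent q) = ?s"
      using False qc r by (auto simp: conjugate_exponent_def)
    have omi: "integrable ?M (\<lambda>t. \<bar>\<omega>2 t\<bar> powr ?s)" "\<omega>2 \<in> borel_measurable ?M"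
      using C2(2) by (auto simp: Lq_finite(1)[OF ce(1)] ce(2))
    define G where "G = (\<integral>t. \<bar>\<omega>2 t\<bar> powr ?s \<partial>?M)"
    have G: "0 \<le> G" unfolding G_def by (intro integral_nonneg_AE) auto
    define H where "H = 1 + S + G"
    have H: "H \<ge> 0" using G S(1) by (simp add: H_def)
    have le: "(1 + x) * control_dist y z \<le> H * control_dist y z" if "x \<le> S \<or> x \<le> G" for x y z
      using that G S(1) control_dist_nonneg by (intro mult_right_mono) (auto simp: H_def)
    show ?thesis
    proof (intro exI[of _ H] conjI ballI H)
      fix v y z assume vyz: "v \<in> K" "y \<in> K" "z \<in> K"
      note w = Lw[OF vyz(2,3)]
      \<comment> \<open>The identity (q - 1) * q' = q: the growth order q - 1 puts the weight in the
        conjugate space, with integral bounded by S.\<close>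
      have pwp: "pw (snd v t) powr ?s = norm (snd v t) powr ?r" for t
        using r1 r by (simp add: pw_def powr_powr)
      have m: "(\<lambda>t. pw (snd v t)) \<in> borel_measurable ?M"
        unfolding pw_def using admissible_measurable(2)[OF vyz(1)] r1 by measurable
      have pos: "0 \<le> pw v" for v by (simp add: pw_def)
      have pi: "integrable ?M (\<lambda>t. pw (snd v t) powr ?s)"
        unfolding pwp by (rule ui[OF vyz(1)])
      note b1 = conjugate_product_bound[OF T q2 qc m pos pi w, unfolded pwp, folded control_dist_def]
      show "integrable ?M (\<lambda>t. pw (snd v t) * norm (snd y t - snd z t))" by (rule b1(1))
      show "(\<integral>t. pw (snd v t) * norm (snd y t - snd z t) \<partial>?M) \<le> H * control_dist y z"
        using b1(2) le S(2)[OF vyz(1)] by (meson order_trans)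
      have m2: "(\<lambda>t. \<bar>\<omega>2 t\<bar>) \<in> borel_measurable ?M" using omi(2) by measurable
      note b2 = conjugate_product_bound[OF T q2 qc m2 abs_ge_zero omi(1) w, folded control_dist_def G_def]
      show "integrable ?M (\<lambda>t. \<bar>\<omega>2 t\<bar> * norm (snd y t - snd z t))" by (rule b2(1))
      show "(\<integral>t. \<bar>\<omega>2 t\<bar> * norm (snd y t - snd z t) \<partial>?M) \<le> H * control_dist y z"
        using b2(2) le[of G y z] by linarith
    qed
  qed
  then obtain H where H: "H \<ge> 0" "\<And>v y z. v \<in> K \<Longrightarrow> y \<in> K \<Longrightarrow> z \<in> K \<Longrightarrow>
      integrable ?M (\<lambda>t. pw (snd v t) * norm (snd y t - snd z t)) \<and>
      (\<integral>t. pw (snd v t) * norm (snd y t - snd z t) \<partial>?M) \<le> H * control_dist y z \<and>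
      integrable ?M (\<lambda>t. \<bar>\<omega>2 t\<bar> * norm (snd y t - snd z t)) \<and>
      (\<integral>t. \<bar>\<omega>2 t\<bar> * norm (snd y t - snd z t) \<partial>?M) \<le> H * control_dist y z" by blast
  have om1: "integrable ?M \<omega>1" using C1(2) by (simp add: L1_space_iff)
  define Ca where "Ca = C1 * S + (\<integral>t. \<omega>1 t \<partial>?M)"
  \<comment> \<open>The 2 counts the weights of both controls, since an intermediate control is
    bounded by the larger of the two; the last H stands for \<open>\<omega>2\<close>.\<close>
  define Cb where "Cb = 2 * C2 * H + H"
  have nn: "0 \<le> Ca" "0 \<le> Cb"
    using C1 C2 S H integral_nonneg_AE[OF C1(3)] by (auto simp: Ca_def Cb_def)
  have "\<bar>cost T \<theta> y - cost T \<theta> z\<bar> \<le> (Ca * \<kappa> + Cb) * control_dist y z"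
    if y: "y \<in> K" and z: "z \<in> K" for y z
  proof (rule cost_lipschitz_if_integrand_bound[where \<theta> = \<theta>, OF y z integrand_integrable_growth[OF qc growth(1)]])
    let ?\<alpha> = "\<lambda>t. C1 * norm (snd y t) powr ?r + \<omega>1 t"
    let ?\<beta> = "\<lambda>t. C2 * (pw (snd y t) + pw (snd z t)) + \<bar>\<omega>2 t\<bar>"
    let ?w = "\<lambda>t. norm (snd y t - snd z t)"
    show "integrable ?M ?\<alpha>" using ui[OF y] om1 by simp
    have "(\<integral>t. ?\<alpha> t \<partial>?M) = C1 * (\<integral>t. norm (snd y t) powr ?r \<partial>?M) + (\<integral>t. \<omega>1 t \<partial>?M)"
      using ui[OF y] om1 by simp
    also have "\<dots> \<le> Ca"
      using S(2)[OF y] C1(1) by (simp add: Ca_def)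
    finally show "(\<integral>t. ?\<alpha> t \<partial>?M) \<le> Ca" .
    show "AE t in ?M. 0 \<le> ?\<alpha> t"
      using C1(3) by eventually_elim (use C1(1) in simp)
    note Hy = H(2)[OF y y z] and Hz = H(2)[OF z y z]
    have eq: "(\<lambda>t. ?\<beta> t * ?w t) = (\<lambda>t. C2 * (pw (snd y t) * ?w t) + C2 * (pw (snd z t) * ?w t) + \<bar>\<omega>2 t\<bar> * ?w t)"
      by (simp add: algebra_simps)
    show "integrable ?M (\<lambda>t. ?\<beta> t * ?w t)"
      unfolding eq using Hy Hz by (intro Bochner_Integration.integrable_add integrable_mult_right) auto
    have "(\<integral>t. ?\<beta> t * ?w t \<partial>?M) = C2 * (\<integral>t. pw (snd y t) * ?w t \<partial>?M)
        + C2 * (\<integral>t. pw (snd z t) * ?w t \<partial>?M) + (\<integral>t. \<bar>\<omega>2 t\<bar> * ?w t \<partial>?M)"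
      unfolding eq using Hy Hz by simp
    also have "\<dots> \<le> C2 * (H * control_dist y z) + C2 * (H * control_dist y z) + H * control_dist y z"
      using Hy Hz C2(1) by (intro add_mono mult_left_mono) auto
    finally show "(\<integral>t. ?\<beta> t * ?w t \<partial>?M) \<le> Cb * control_dist y z"
      by (simp add: Cb_def algebra_simps)
    show "AE t in ?M. \<bar>\<theta> (fst y t) (snd y t) t - \<theta> (fst z t) (snd z t) t\<bar>
       \<le> ?\<alpha> t * norm (fst y t - fst z t) + ?\<beta> t * ?w t"
      using C1(4) C2(4) AE_interval
    proof eventually_elim
      case (elim t)
      show ?case
      proof (rule integrand_diff_le[where \<theta> = \<theta> and \<theta>x = \<theta>x and \<theta>u = \<theta>u and t = t, OF grad_x[OF elim(3)] grad_u[OF elim(3)] R(2)[OF y elim(3)] R(2)[OF z elim(3)]])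
        show "norm (\<theta>x x (snd y t) t) \<le> ?\<alpha> t" if "norm x \<le> R" for x
          using elim(1) that by blast
        fix v :: "real ^ 'm" assume v: "norm v \<le> max (norm (snd y t)) (norm (snd z t))"
        have "norm (\<theta>u (fst z t) v t) \<le> C2 * pw v + \<omega>2 t"
          using elim(2) R(2)[OF z elim(3)] by blast
        also have "\<dots> \<le> ?\<beta> t"
          using pw_max[OF v] C2(1) by (intro add_mono mult_left_mono) auto
        finally show "norm (\<theta>u (fst z t) v t) \<le> ?\<beta> t" .
      qed
    qed
  qed
  then show ?thesis
    using nn \<kappa>_nonneg by (intro exI[of _ "Ca * \<kappa> + Cb"]) auto
qed

lemma bounded_on_compact:
  fixes g :: "real ^ 'd \<Rightarrow> real ^ 'm \<Rightarrow> real \<Rightarrow> 'c::euclidean_space"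
  assumes "continuous_on (UNIV \<times> UNIV \<times> {0..T}) (\<lambda>(x, u, t). g x u t)"
  shows "\<exists>c\<ge>0. \<forall>x u t. norm x \<le> R \<longrightarrow> norm u \<le> C \<longrightarrow> t \<in> {0..T} \<longrightarrow> norm (g x u t) \<le> c"
proof -
  let ?S = "cball 0 R \<times> cball 0 C \<times> {0..T}"
  have "compact ((\<lambda>(x, u, t). g x u t) ` ?S)"
    by (intro compact_continuous_image continuous_on_subset[OF assms] compact_Times) auto
  then obtain c where "\<And>v. v \<in> (\<lambda>(x, u, t). g x u t) ` ?S \<Longrightarrow> norm v \<le> c"
    using compact_imp_bounded bounded_iff by metis
  then have "norm (g x u t) \<le> max c 0" if "norm x \<le> R" "norm u \<le> C" "t \<in> {0..T}" for x u t
    using that by (intro max.coboundedI1) force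
  then show ?thesis by (intro exI[of _ "max c 0"]) auto
qed

text \<open>Controls bounded in the supremum norm take values in one ball almost everywhere, so
  compactness takes over the role of the growth conditions.\<close>

lemma cost_lipschitz_infinite:
  assumes qc: "q = \<infinity>"
    and grad_x_cont: "continuous_on (UNIV \<times> UNIV \<times> {0..T}) (\<lambda>(x, u, t). \<theta>x x u t)"
    and grad_u_cont: "continuous_on (UNIV \<times> UNIV \<times> {0..T}) (\<lambda>(x, u, t). \<theta>u x u t)"
  shows "\<exists>L\<ge>0. \<forall>y\<in>K. \<forall>z\<in>K. \<bar>cost T \<theta> y - cost T \<theta> z\<bar> \<le> L * control_dist y z"
proof -
  let ?M = "lebesgue_on {0..T}"
  note q1 = q
  obtain R where R: "R > 0" "\<And>z t. z \<in> K \<Longrightarrow> t \<in> {0..T} \<Longrightarrow> norm (fst z t) \<le> R"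
    using state_bounded by blast
  obtain C where C: "C \<ge> 0" "\<And>u. u \<in> U \<Longrightarrow> Lq_norm T q u \<le> C" using control_bound by blast
  have uC: "AE t in ?M. norm (snd z t) \<le> C" if z: "z \<in> K" for z
    using Linf_AE[OF T admissibleD(3)[OF z, unfolded qc]]
    by eventually_elim (use C(2)[OF admissibleD(4)[OF z], unfolded qc] in simp)
  obtain c0 where c0: "c0 \<ge> 0"
    "\<And>x u t. norm x \<le> R \<Longrightarrow> norm u \<le> C \<Longrightarrow> t \<in> {0..T} \<Longrightarrow> norm (\<theta> x u t) \<le> c0"
    using bounded_on_compact[OF theta_cont] by blast
  obtain c1 where c1: "c1 \<ge> 0"
    "\<And>x u t. norm x \<le> R \<Longrightarrow> norm u \<le> C \<Longrightarrow> t \<in> {0..T} \<Longrightarrow> norm (\<theta>x x u t) \<le> c1"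
    using bounded_on_compact[OF grad_x_cont] by blast
  obtain c2 where c2: "c2 \<ge> 0"
    "\<And>x u t. norm x \<le> R \<Longrightarrow> norm u \<le> C \<Longrightarrow> t \<in> {0..T} \<Longrightarrow> norm (\<theta>u x u t) \<le> c2"
    using bounded_on_compact[OF grad_u_cont] by blast
  have int: "integrable ?M (\<lambda>t. \<theta> (fst z t) (snd z t) t)" if z: "z \<in> K" for z
  proof (rule Bochner_Integration.integrable_bound[OF integral_const_interval(1)[OF T] integrand_measurable[OF z]])
    show "AE t in ?M. norm (\<theta> (fst z t) (snd z t) t) \<le> norm c0"
      using uC[OF z] AE_interval
      by eventually_elim (use c0 R(2)[OF z] in force)
  qed
  have "\<bar>cost T \<theta> y - cost T \<theta> z\<bar> \<le> (c1 * T * \<kappa> + c2 * (T + 1)) * control_dist y z"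
    if y: "y \<in> K" and z: "z \<in> K" for y z
  proof (rule cost_lipschitz_if_integrand_bound[where \<theta> = \<theta> and \<alpha> = "\<lambda>t. c1" and \<beta> = "\<lambda>t. c2", OF y z int])
    show "integrable ?M (\<lambda>t. c1)" "(\<integral>t. c1 \<partial>?M) \<le> c1 * T" "AE t in ?M. 0 \<le> c1"
      using integral_const_interval[OF T, of c1] c1(1) by auto
    have w: "(\<lambda>t. snd y t - snd z t) \<in> Lq_space T q"
      using y z by (intro Lq_diff[OF T q1] admissibleD(3))
    note wi = Lq_integrable[OF T q1 w]
    show "integrable ?M (\<lambda>t. c2 * norm (snd y t - snd z t))" using wi(1) by simp
    show "(\<integral>t. c2 * norm (snd y t - snd z t) \<partial>?M) \<le> c2 * (T + 1) * control_dist y z"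
      using mult_left_mono[OF wi(2) c2(1)] by (simp add: control_dist_def mult_ac)
    show "AE t in ?M. \<bar>\<theta> (fst y t) (snd y t) t - \<theta> (fst z t) (snd z t) t\<bar>
       \<le> c1 * norm (fst y t - fst z t) + c2 * norm (snd y t - snd z t)"
      using uC[OF y] uC[OF z] AE_interval
    proof eventually_elim
      case (elim t)
      show ?case
        by (rule integrand_diff_le[where \<theta> = \<theta> and \<theta>x = \<theta>x and \<theta>u = \<theta>u and t = t, OF grad_x[OF elim(3)] grad_u[OF elim(3)] R(2)[OF y elim(3)] R(2)[OF z elim(3)]])
           (use c1(2) c2(2) elim R(2)[OF z elim(3)] in auto)
    qed
  qed
  then show ?thesis
    using c1(1) c2(1) \<kappa>_nonneg T by (intro exI[of _ "c1 * T * \<kappa> + c2 * (T + 1)"]) auto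
qed

end

theorem theorem7:
  fixes p q :: ennreal and T :: real
    and x0 xT :: "real ^ 'd::finite"
    and U :: "(real \<Rightarrow> real ^ 'm::finite) set"
    and A :: "real \<Rightarrow> real ^ 'd ^ 'd" and B :: "real \<Rightarrow> real ^ 'm ^ 'd"
    and \<theta> :: "real ^ 'd \<Rightarrow> real ^ 'm \<Rightarrow> real \<Rightarrow> real"
    and \<theta>x :: "real ^ 'd \<Rightarrow> real ^ 'm \<Rightarrow> real \<Rightarrow> real ^ 'd"
    and \<theta>u :: "real ^ 'd \<Rightarrow> real ^ 'm \<Rightarrow> real \<Rightarrow> real ^ 'm"
  assumes exponents: "1 \<le> p" "p \<le> q"
    and T_pos: "0 < T"
    and U_set: "U \<subseteq> Lq_space T q" "closed_Lq T q U" "convex_fun_set U"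
    and coefficients: "A \<in> Lq_space T \<infinity>" "B \<in> Lq_space T \<infinity>"
    and theta_cont: "continuous_on (UNIV \<times> UNIV \<times> {0..T}) (\<lambda>(x, u, t). \<theta> x u t)"
    and grad_x: "\<And>x u t. t \<in> {0..T} \<Longrightarrow> GDERIV (\<lambda>y. \<theta> y u t) x :> \<theta>x x u t"
    and grad_u: "\<And>x u t. t \<in> {0..T} \<Longrightarrow> GDERIV (\<lambda>v. \<theta> x v t) u :> \<theta>u x u t"
    and grad_x_cont: "continuous_on (UNIV \<times> UNIV \<times> {0..T}) (\<lambda>(x, u, t). \<theta>x x u t)"
    and grad_u_cont: "continuous_on (UNIV \<times> UNIV \<times> {0..T}) (\<lambda>(x, u, t). \<theta>u x u t)"
    and growth: "q = \<infinity> \<or>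
      (growth_condition T (enn2real q) 1 \<theta> \<and> growth_condition T (enn2real q) 1 \<theta>x \<and>
       growth_condition T (enn2real q - 1) (conjugate_exponent q) \<theta>u)"
    and solution: "\<exists>z. global_min_on (cost T \<theta>)
      (feasible_set (endpoint_penalty T xT) (admissible_set T p q A B U x0)) z"
    and relint: "xT \<in> rel_interior (reachable_set T p q A B U x0)"
    and U_bounded: "bounded_Lq T q U"
  shows "completely_exact (X_dist T p q) (cost T \<theta>) (endpoint_penalty T xT)
    (admissible_set T p q A B U x0)"
proof -
  interpret control_problem p q T x0 U A B \<theta> \<theta>x \<theta>u
    by unfold_locales (fact exponents T_pos U_set U_bounded coefficients theta_cont grad_x grad_u)+
  obtain L where L: "0 \<le> L"
    "\<And>y z. y \<in> K \<Longrightarrow> z \<in> K \<Longrightarrow> \<bar>cost T \<theta> y - cost T \<theta> z\<bar> \<le> L * control_dist y z"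
    using growth cost_lipschitz_finite cost_lipschitz_infinite[OF _ grad_x_cont grad_u_cont]
    by metis
  obtain k where k: "0 < k" "\<And>y z. y \<in> K \<Longrightarrow> z \<in> K \<Longrightarrow> X_dist T p q y z \<le> k * control_dist y z"
    using X_dist_le_control_dist by blast
  obtain a where a: "0 < a" "\<And>z s. z \<in> K \<Longrightarrow> 0 < endpoint_penalty T xT z \<Longrightarrow> 0 < s \<Longrightarrow> s \<le> 1 \<Longrightarrow>
     \<exists>y\<in>K. endpoint_penalty T xT y = (1 - s) * endpoint_penalty T xT z \<and>
        control_dist y z \<le> s * (a * endpoint_penalty T xT z)"
    using endpoint_error_bound[OF relint] by blast
  \<comment> \<open>The state estimate evaluated at the final time.\<close>
  have phi: "endpoint_penalty T xT y - endpoint_penalty T xT z \<le> \<kappa> * control_dist y z"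
    if "y \<in> K" "z \<in> K" for y z
    using state_diff_le[OF that, of T] T norm_triangle_ineq2[of "fst y T - xT" "fst z T - xT"]
    by (simp add: endpoint_penalty_def)
  show ?thesis
    by (rule completely_exact_if_error_bound[where n = control_dist, OF control_dist_le_X_dist k(2)
          control_dist_nonneg control_dist_refl control_dist_sym control_dist_triangle L(2) phi _
          k(1) L(1) \<kappa>_nonneg a(1) a(2)])
       (auto simp: endpoint_penalty_def)
qed

end
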